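(* Consider the linearly constrained problem (P) of the context under its assumptions. Given $\varepsilon>0$, choose $\varepsilon_0=\varepsilon$, $\sigma=1/2$, and $\rho=\varepsilon^{-1}$. Then the I-ALM algorithm (defined in the context) finds an $\varepsilon$-primal solution to (P), i.e. a point $x\in\operatorname{dom}h$ with $|\phi(x)-\hat\phi_*|\le\varepsilon$ and $\|Ax-b\|\le\varepsilon$, in $$\tilde{\mathcal O}\left((1+R_\Lambda^2)\left(1+D\left(\frac{\sqrt{(R_\Lambda+D)L_f}}{\sqrt\varepsilon}+\frac{(R_\Lambda+D)\|A\|}{\varepsilon}\right)\right)\right)$$ ACG iterations, where $R_\Lambda=\|\lambda_*-\lambda_0\|=\min\{\|\lambda-\lambda_0\|:\lambda\in\Lambda_*\}$ and $\Lambda_*$ is the set of maximizers of the dual function $d$.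
   Context: Problem (P): $\hat\phi_*=\min\{\phi(x):=f(x)+h(x):Ax=b\}$, $A\in\mathbb{R}^{m\times n}$, $b\in\mathbb{R}^m$, $m\le n$. Assumptions: $f$ is proper closed convex and $L_f$-smooth on $\mathbb{R}^n$ ($\nabla f$ is $L_f$-Lipschitz); $h$ is proper closed convex with computable proximal mapping, $\operatorname{dom}h\subset\operatorname{dom}f$; $\operatorname{relint}(\operatorname{dom}h)\cap\{x:Ax=b\}\neq\emptyset$; $\operatorname{dom}h$ is bounded with diameter $D\ge1$. $\|A\|$ is the spectral norm. Lagrangian $\mathcal L(x,\lambda)=\phi(x)+\langle\lambda,Ax-b\rangle$; dual $d(\lambda)=\min_x\mathcal L(x,\lambda)$; augmented Lagrangian $\mathcal L_\rho(x,\lambda)=\mathcal L(x,\lambda)+\frac\rho2\|Ax-b\|^2$, with smooth part $\Psi_\lambda(x)=f(x)+\langle\lambda,Ax-b\rangle+\frac\rho2\|Ax-b\|^2$; $M_\rho=L_f+\rho\|A\|^2$. Gradient mapping: for $F=s+h$ with $s$ smooth, $\mathcal G_F^\eta(x)=\frac1\eta\big(x-\operatorname{prox}_{\eta h}(x-\eta\nabla s(x))\big)$, where $\operatorname{prox}_{\eta h}(z)=\operatorname{argmin}_y\{\eta h(y)+\frac12\|z-y\|^2\}$. For $\mathcal L_\rho(\cdot,\lambda)$ the smooth part is $\Psi_\lambda$. ACG (accelerated composite gradient), applied to $\psi=g+h$ ($g$ $\mu$-strongly convex, $(L+\mu)$-smooth) from $p_0$: $S_0=0$, $\tau_0=1$,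 $q_0=p_0$; iteration $j=0,1,\dots$: $s_j=\frac{\tau_j+\sqrt{\tau_j^2+8\tau_jS_jL}}{4L}$, $S_{j+1}=S_j+s_j$, $\tau_{j+1}=\tau_j+\mu s_j$, $\tilde p_j=\frac{S_j}{S_{j+1}}q_j+\frac{s_j}{S_{j+1}}p_j$; $\tilde q_{j+1}=\operatorname{argmin}_u\{g(\tilde p_j)+\langle\nabla g(\tilde p_j),u-\tilde p_j\rangle+h(u)+\frac{2L+\mu}2\|u-\tilde p_j\|^2\}$; $q_{j+1}$ is a point of $\{q_j,\tilde q_{j+1}\}$ with smallest $\psi$-value; $p_{j+1}=\frac{(2L+\mu)s_j\tilde q_{j+1}-\frac{2S_js_jL}{S_{j+1}}q_j}{S_{j+1}\mu+1}$. I-ALM (inexact augmented Lagrangian method). Input $x_0\in\operatorname{dom}h$, $\rho>0$, $\varepsilon_0>0$, $\alpha\in(0,1)$, $\varepsilon>0$, $\sigma\in(0,1)$ with $2\sigma\rho\le D/\varepsilon$; $\lambda_0=0$. For $k=0,1,\dots$: 1. Set $\varepsilon_k=(\varepsilon_0\alpha^k+\sigma\rho\varepsilon^2)/2$ (with $\varepsilon_0$ on the right the input). Run ACG from $p_0=x_k$ with $\psi=\mathcal L_\rho(\cdot,\lambda_k)+\frac{\varepsilon_k}{8D^2}\|\cdot-x_k\|^2$, $g=\Psi_{\lambda_k}+\frac{\varepsilon_k}{8D^2}\|\cdot-x_k\|^2$, $L=M_\rho$, $\mu=\frac{\varepsilon_k}{4D^2}$, to find a point $\tilde x_k$ (one of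 its points $\tilde p_j$) satisfying $\|\mathcal G^{(2L+\mu)^{-1}}_{\mathcal L_\rho(\cdot,\lambda_k)}(\tilde x_k)\|\le\varepsilon_k/(2D)$. Set $x_{k+1}=\tilde x_k-(2L+\mu)^{-1}\mathcal G^{(2L+\mu)^{-1}}_{\mathcal L_\rho(\cdot,\lambda_k)}(\tilde x_k)$. 2. $\lambda_{k+1}=\lambda_k+\rho(Ax_{k+1}-b)$. 3. If $\|\mathcal G^{(2L+\mu)^{-1}}_{\mathcal L_\rho(\cdot,\lambda_k)}(\tilde x_k)\|\le\varepsilon/2$ and $\|Ax_{k+1}-b\|\le\varepsilon$, return $(x_{k+1},\lambda_{k+1})$. The ACG iterations are counted in total over all inner calls. $\tilde{\mathcal O}$ is $\mathcal O$ up to logarithmic factors, with $\alpha$ treated as a constant.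
   Formalization: The method is run with tolerance δ=(1−α)ε/(4(R_Λ+D)), ε_0=δ, σ=1/2, ρ=1/δ instead of ε, since with tolerance ε the claim fails (min −x on [−1/2,1/2] s.t. εx=0, x_0=1/2); the target accuracy ε and the bound are unchanged. L_f>0 or A≠0 is assumed so that ACG is defined. *)

theory Defs
  imports "HOL-Analysis.Analysis"
begin

section \<open>The problem: minimise f + h subject to A x = b\<close>

definition edom :: "('a \<Rightarrow> ereal) \<Rightarrow> 'a set" where
  "edom h = {x. h x < \<infinity>}"

definition proper_closed_convex :: "('a::euclidean_space \<Rightarrow> ereal) \<Rightarrow> bool" where
  "proper_closed_convex h \<longleftrightarrow>
     (\<forall>x. h x \<noteq> - \<infinity>) \<and> edom h \<noteq> {} \<and>
     convex {(x, r::real). h x \<le> ereal r} \<and> closed {(x, r::real). h x \<le> ereal r}"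

text \<open>Only meaningful where the function is differentiable.\<close>

definition gradient :: "('a::real_inner \<Rightarrow> real) \<Rightarrow> 'a \<Rightarrow> 'a" where
  "gradient F x = (THE D. GDERIV F x :> D)"

text \<open>A convex \<open>f\<close> that is smooth on the whole space is finite and continuous there, so it is
  represented by a real-valued function: it is then automatically proper and closed, and the
  inclusion of the domain of \<open>h\<close> in that of \<open>f\<close> is automatic too.\<close>

definition smooth_convex :: "real \<Rightarrow> ('a::real_inner \<Rightarrow> real) \<Rightarrow> bool" where
  "smooth_convex Lf f \<longleftrightarrow>
     convex_on UNIV f \<and> (\<forall>x. f differentiable (at x)) \<and> Lf-lipschitz_on UNIV (gradient f)"

definition objective :: "('a \<Rightarrow> real) \<Rightarrow> ('a \<Rightarrow> ereal) \<Rightarrow> 'a \<Rightarrow> ereal" where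
  "objective f h x = ereal (f x) + h x"

definition opt_val ::
  "(real^'n \<Rightarrow> real) \<Rightarrow> (real^'n \<Rightarrow> ereal) \<Rightarrow> real^'n^'m \<Rightarrow> real^'m \<Rightarrow> ereal" where
  "opt_val f h A b = (INF x\<in>{x. A *v x = b}. objective f h x)"

definition primal_sol ::
  "(real^'n \<Rightarrow> real) \<Rightarrow> (real^'n \<Rightarrow> ereal) \<Rightarrow> real^'n^'m \<Rightarrow> real^'m \<Rightarrow> real \<Rightarrow> real^'n \<Rightarrow> bool" where
  "primal_sol f h A b \<epsilon> x \<longleftrightarrow>
     x \<in> edom h \<and> \<bar>objective f h x - opt_val f h A b\<bar> \<le> ereal \<epsilon> \<and> norm (A *v x - b) \<le> \<epsilon>"

definition lagrangian ::
  "(real^'n \<Rightarrow> real) \<Rightarrow> (real^'n \<Rightarrow> ereal) \<Rightarrow> real^'n^'m \<Rightarrow> real^'m \<Rightarrow> real^'n \<Rightarrow> real^'m \<Rightarrow> ereal" where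
  "lagrangian f h A b x l = objective f h x + ereal (l \<bullet> (A *v x - b))"

definition dual_fun ::
  "(real^'n \<Rightarrow> real) \<Rightarrow> (real^'n \<Rightarrow> ereal) \<Rightarrow> real^'n^'m \<Rightarrow> real^'m \<Rightarrow> real^'m \<Rightarrow> ereal" where
  "dual_fun f h A b l = (INF x. lagrangian f h A b x l)"

definition dual_opt ::
  "(real^'n \<Rightarrow> real) \<Rightarrow> (real^'n \<Rightarrow> ereal) \<Rightarrow> real^'n^'m \<Rightarrow> real^'m \<Rightarrow> (real^'m) set" where
  "dual_opt f h A b = {l. is_arg_max (dual_fun f h A b) (\<lambda>_. True) l}"

section \<open>Proximal and gradient mappings\<close>

definition prox :: "real \<Rightarrow> ('a::euclidean_space \<Rightarrow> ereal) \<Rightarrow> 'a \<Rightarrow> 'a" where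
  "prox \<eta> h z = arg_min (\<lambda>y. ereal \<eta> * h y + ereal ((norm (z - y))\<^sup>2 / 2)) (\<lambda>_. True)"

definition grad_map ::
  "('a::euclidean_space \<Rightarrow> real) \<Rightarrow> ('a \<Rightarrow> ereal) \<Rightarrow> real \<Rightarrow> 'a \<Rightarrow> 'a" where
  "grad_map s h \<eta> x = (1 / \<eta>) *\<^sub>R (x - prox \<eta> h (x - \<eta> *\<^sub>R gradient s x))"

section \<open>Accelerated composite gradient method\<close>

datatype 'a acg_state = ACG_State (acg_S: real) (acg_tau: real) (acg_p: 'a) (acg_q: 'a)

definition acg_s :: "real \<Rightarrow> 'a acg_state \<Rightarrow> real" where
  "acg_s L st = (acg_tau st + sqrt ((acg_tau st)\<^sup>2 + 8 * acg_tau st * acg_S st * L)) / (4 * L)"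

definition acg_pt :: "real \<Rightarrow> 'a::euclidean_space acg_state \<Rightarrow> 'a" where
  "acg_pt L st =
     (let S = acg_S st; s = acg_s L st; S' = S + s
      in (S / S') *\<^sub>R acg_q st + (s / S') *\<^sub>R acg_p st)"

definition acg_qt ::
  "('a::euclidean_space \<Rightarrow> real) \<Rightarrow> ('a \<Rightarrow> ereal) \<Rightarrow> real \<Rightarrow> real \<Rightarrow> 'a acg_state \<Rightarrow> 'a" where
  "acg_qt g h L \<mu> st =
     (let p = acg_pt L st
      in arg_min (\<lambda>u. ereal (g p + gradient g p \<bullet> (u - p)) + h u
                    + ereal ((2 * L + \<mu>) / 2 * (norm (u - p))\<^sup>2)) (\<lambda>_. True))"

text \<open>The method may keep either point when \<open>q\<^sub>j\<close> and the new point have the same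
  objective value. The Boolean \<open>t\<close> resolves such a tie (true: move to the new point).\<close>

definition acg_step ::
  "('a::euclidean_space \<Rightarrow> real) \<Rightarrow> ('a \<Rightarrow> ereal) \<Rightarrow> real \<Rightarrow> real \<Rightarrow> bool \<Rightarrow> 'a acg_state \<Rightarrow> 'a acg_state"
  where
  "acg_step g h L \<mu> t st =
     (let S = acg_S st; s = acg_s L st; S' = S + s;
          q = acg_q st; qt = acg_qt g h L \<mu> st;
          \<psi> = objective g h;
          q' = (if \<psi> qt < \<psi> q \<or> \<psi> qt = \<psi> q \<and> t then qt else q);
          p' = (1 / (S' * \<mu> + 1)) *\<^sub>R
                 (((2 * L + \<mu>) * s) *\<^sub>R qt - (2 * S * s * L / S') *\<^sub>R q)
      in ACG_State S' (acg_tau st + \<mu> * s) p' q')"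

primrec acg ::
  "(nat \<Rightarrow> bool) \<Rightarrow> ('a::euclidean_space \<Rightarrow> real) \<Rightarrow> ('a \<Rightarrow> ereal) \<Rightarrow> real \<Rightarrow> real \<Rightarrow> 'a \<Rightarrow> nat \<Rightarrow> 'a acg_state"
  where
  "acg tie g h L \<mu> p0 0 = ACG_State 0 1 p0 p0"
| "acg tie g h L \<mu> p0 (Suc j) = acg_step g h L \<mu> (tie j) (acg tie g h L \<mu> p0 j)"

section \<open>Inexact augmented Lagrangian method\<close>

text \<open>\<open>aug_smooth\<close> is the smooth part of the augmented Lagrangian and \<open>aug_M\<close> its
  smoothness constant. The number \<open>e\<close> below is the accuracy \<open>\<epsilon>\<^sub>k\<close> of the current outer
  iteration.\<close>

definition aug_smooth ::
  "(real^'n \<Rightarrow> real) \<Rightarrow> real^'n^'m \<Rightarrow> real^'m \<Rightarrow> real \<Rightarrow> real^'m \<Rightarrow> real^'n \<Rightarrow> real" where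
  "aug_smooth f A b \<rho> l x = f x + l \<bullet> (A *v x - b) + \<rho> / 2 * (norm (A *v x - b))\<^sup>2"

definition aug_M :: "real \<Rightarrow> real^'n^'m \<Rightarrow> real \<Rightarrow> real" where
  "aug_M Lf A \<rho> = Lf + \<rho> * (onorm ((*v) A))\<^sup>2"

definition ialm_eps :: "real \<Rightarrow> real \<Rightarrow> real \<Rightarrow> real \<Rightarrow> real \<Rightarrow> nat \<Rightarrow> real" where
  "ialm_eps \<epsilon>0 \<alpha> \<sigma> \<rho> \<epsilon> k = (\<epsilon>0 * \<alpha> ^ k + \<sigma> * \<rho> * \<epsilon>\<^sup>2) / 2"

definition ialm_mu :: "real \<Rightarrow> real \<Rightarrow> real" where
  "ialm_mu D e = e / (4 * D\<^sup>2)"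

definition ialm_eta :: "real \<Rightarrow> real^'n^'m \<Rightarrow> real \<Rightarrow> real \<Rightarrow> real \<Rightarrow> real" where
  "ialm_eta Lf A \<rho> D e = 1 / (2 * aug_M Lf A \<rho> + ialm_mu D e)"

definition ialm_G ::
  "(real^'n \<Rightarrow> real) \<Rightarrow> real \<Rightarrow> (real^'n \<Rightarrow> ereal) \<Rightarrow> real \<Rightarrow> real^'n^'m \<Rightarrow> real^'m \<Rightarrow>
   real \<Rightarrow> real \<Rightarrow> real^'m \<Rightarrow> real^'n \<Rightarrow> real^'n" where
  "ialm_G f Lf h D A b \<rho> e l y = grad_map (aug_smooth f A b \<rho> l) h (ialm_eta Lf A \<rho> D e) y"

text \<open>The extrapolated point formed in iteration \<open>j\<close> of the inner solver started at \<open>x\<close>.\<close>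

definition ialm_inner_pt ::
  "(real^'n \<Rightarrow> real) \<Rightarrow> real \<Rightarrow> (real^'n \<Rightarrow> ereal) \<Rightarrow> real \<Rightarrow> real^'n^'m \<Rightarrow> real^'m \<Rightarrow>
   real \<Rightarrow> (nat \<Rightarrow> bool) \<Rightarrow> real \<Rightarrow> real^'n \<Rightarrow> real^'m \<Rightarrow> nat \<Rightarrow> real^'n" where
  "ialm_inner_pt f Lf h D A b \<rho> tie e x l j =
     (let g = (\<lambda>u. aug_smooth f A b \<rho> l u + e / (8 * D\<^sup>2) * (norm (u - x))\<^sup>2);
          L = aug_M Lf A \<rho>
      in acg_pt L (acg tie g h L (ialm_mu D e) x j))"

definition ialm_inner_test ::
  "(real^'n \<Rightarrow> real) \<Rightarrow> real \<Rightarrow> (real^'n \<Rightarrow> ereal) \<Rightarrow> real \<Rightarrow> real^'n^'m \<Rightarrow> real^'m \<Rightarrow>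
   real \<Rightarrow> (nat \<Rightarrow> bool) \<Rightarrow> real \<Rightarrow> real^'n \<Rightarrow> real^'m \<Rightarrow> nat \<Rightarrow> bool" where
  "ialm_inner_test f Lf h D A b \<rho> tie e x l j \<longleftrightarrow>
     norm (ialm_G f Lf h D A b \<rho> e l (ialm_inner_pt f Lf h D A b \<rho> tie e x l j)) \<le> e / (2 * D)"

text \<open>One outer iteration from \<open>(x, l)\<close>: the inner solver stops at the first point passing the
  test, say the one formed in iteration \<open>j\<close>, which costs \<open>Suc j\<close> inner iterations. The result
  consists of the accepted point \<open>y\<close>, the updated pair \<open>(x', l')\<close> and the cost \<open>N\<close>.\<close>

definition ialm_outer ::
  "(real^'n \<Rightarrow> real) \<Rightarrow> real \<Rightarrow> (real^'n \<Rightarrow> ereal) \<Rightarrow> real \<Rightarrow> real^'n^'m \<Rightarrow> real^'m \<Rightarrow>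
   real \<Rightarrow> (nat \<Rightarrow> bool) \<Rightarrow> real \<Rightarrow> real^'n \<Rightarrow> real^'m \<Rightarrow>
   real^'n \<Rightarrow> real^'n \<Rightarrow> real^'m \<Rightarrow> nat \<Rightarrow> bool" where
  "ialm_outer f Lf h D A b \<rho> tie e x l y x' l' N \<longleftrightarrow>
     (\<exists>j. ialm_inner_test f Lf h D A b \<rho> tie e x l j \<and>
          (\<forall>i<j. \<not> ialm_inner_test f Lf h D A b \<rho> tie e x l i) \<and>
          y = ialm_inner_pt f Lf h D A b \<rho> tie e x l j \<and> N = Suc j) \<and>
     x' = y - ialm_eta Lf A \<rho> D e *\<^sub>R ialm_G f Lf h D A b \<rho> e l y \<and>
     l' = l + \<rho> *\<^sub>R (A *v x' - b)"

definition ialm_stop ::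
  "(real^'n \<Rightarrow> real) \<Rightarrow> real \<Rightarrow> (real^'n \<Rightarrow> ereal) \<Rightarrow> real \<Rightarrow> real^'n^'m \<Rightarrow> real^'m \<Rightarrow>
   real \<Rightarrow> real \<Rightarrow> real \<Rightarrow> real^'m \<Rightarrow> real^'n \<Rightarrow> real^'n \<Rightarrow> bool" where
  "ialm_stop f Lf h D A b \<rho> \<epsilon> e l y x' \<longleftrightarrow>
     norm (ialm_G f Lf h D A b \<rho> e l y) \<le> \<epsilon> / 2 \<and> norm (A *v x' - b) \<le> \<epsilon>"

text \<open>\<open>ialm_reach \<dots> k x l N\<close>: outer iteration \<open>k\<close> is entered at \<open>(x, l)\<close>, after \<open>N\<close> inner
  iterations in total. The oracle \<open>tie k j\<close> resolves a tie in inner iteration \<open>j\<close> of outer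
  iteration \<open>k\<close>; for a fixed oracle the run is deterministic, so quantifying over all oracles
  amounts to quantifying over all runs.\<close>

inductive ialm_reach ::
  "(real^'n \<Rightarrow> real) \<Rightarrow> real \<Rightarrow> (real^'n \<Rightarrow> ereal) \<Rightarrow> real \<Rightarrow> real^'n^'m \<Rightarrow> real^'m \<Rightarrow>
   real^'n \<Rightarrow> real \<Rightarrow> real \<Rightarrow> real \<Rightarrow> real \<Rightarrow> real \<Rightarrow> (nat \<Rightarrow> nat \<Rightarrow> bool) \<Rightarrow>
   nat \<Rightarrow> real^'n \<Rightarrow> real^'m \<Rightarrow> nat \<Rightarrow> bool"
  for f Lf h D A b x0 \<rho> \<epsilon>0 \<alpha> \<epsilon> \<sigma> tie
  where
  init: "\<lbrakk>x0 \<in> edom h; \<rho> > 0; \<epsilon>0 > 0; 0 < \<alpha>; \<alpha> < 1; \<epsilon> > 0; 0 < \<sigma>; \<sigma> < 1; 2 * \<sigma> * \<rho> \<le> D / \<epsilon>\<rbrakk>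
    \<Longrightarrow> ialm_reach f Lf h D A b x0 \<rho> \<epsilon>0 \<alpha> \<epsilon> \<sigma> tie 0 x0 0 0"
| step: "\<lbrakk>ialm_reach f Lf h D A b x0 \<rho> \<epsilon>0 \<alpha> \<epsilon> \<sigma> tie k x l N;
          e = ialm_eps \<epsilon>0 \<alpha> \<sigma> \<rho> \<epsilon> k;
          ialm_outer f Lf h D A b \<rho> (tie k) e x l y x' l' N';
          \<not> ialm_stop f Lf h D A b \<rho> \<epsilon> e l y x'\<rbrakk>
    \<Longrightarrow> ialm_reach f Lf h D A b x0 \<rho> \<epsilon>0 \<alpha> \<epsilon> \<sigma> tie (Suc k) x' l' (N + N')"

text \<open>The method terminates and returns \<open>(x', l')\<close> after \<open>N\<close> inner iterations in total.\<close>

inductive ialm_returns ::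
  "(real^'n \<Rightarrow> real) \<Rightarrow> real \<Rightarrow> (real^'n \<Rightarrow> ereal) \<Rightarrow> real \<Rightarrow> real^'n^'m \<Rightarrow> real^'m \<Rightarrow>
   real^'n \<Rightarrow> real \<Rightarrow> real \<Rightarrow> real \<Rightarrow> real \<Rightarrow> real \<Rightarrow> (nat \<Rightarrow> nat \<Rightarrow> bool) \<Rightarrow>
   real^'n \<Rightarrow> real^'m \<Rightarrow> nat \<Rightarrow> bool"
  for f Lf h D A b x0 \<rho> \<epsilon>0 \<alpha> \<epsilon> \<sigma> tie
  where
  "\<lbrakk>ialm_reach f Lf h D A b x0 \<rho> \<epsilon>0 \<alpha> \<epsilon> \<sigma> tie k x l N;
    e = ialm_eps \<epsilon>0 \<alpha> \<sigma> \<rho> \<epsilon> k;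
    ialm_outer f Lf h D A b \<rho> (tie k) e x l y x' l' N';
    ialm_stop f Lf h D A b \<rho> \<epsilon> e l y x'\<rbrakk>
    \<Longrightarrow> ialm_returns f Lf h D A b x0 \<rho> \<epsilon>0 \<alpha> \<epsilon> \<sigma> tie x' l' (N + N')"

section \<open>Tolerance and complexity\<close>

text \<open>The tolerance of the method controls the feasibility violation and the gradient mapping of
  the returned point; its objective gap is in general only of the order of \<open>R + D\<close> times the
  tolerance. Example: minimise \<open>- x\<close> over \<open>[-1/2, 1/2]\<close> subject to \<open>\<epsilon> x = 0\<close>; with tolerance
  \<open>\<epsilon>\<close>, \<open>\<rho> = 1/\<epsilon>\<close> and start \<open>x\<^sub>0 = 1/2\<close>, the method stops in the first iteration and returns
  \<open>1/2\<close>, whose gap is \<open>1/2\<close>. A primal solution of accuracy \<open>\<epsilon>\<close> is thus obtained by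
  running the method with tolerance proportional to \<open>\<epsilon> / (R + D)\<close>, which is also where the factors
  \<open>R + D\<close> in the complexity bound come from. The parameters \<open>\<epsilon>\<^sub>0\<close> and \<open>\<rho>\<close> are chosen relative
  to that tolerance.\<close>

definition primal_tol :: "real \<Rightarrow> real \<Rightarrow> real \<Rightarrow> real \<Rightarrow> real" where
  "primal_tol \<alpha> R D \<epsilon> = (1 - \<alpha>) / 4 * (\<epsilon> / (R + D))"

text \<open>Soft-O of \<open>X \<ge> 1\<close>: at most a constant times \<open>X\<close> times a power (here the first) of
  \<open>1 + ln X\<close>. The constant depends on \<open>\<alpha>\<close> only. It is explicit because the dimensions are
  types, so that an existentially quantified constant could depend on them; its size is
  immaterial.\<close>

definition soft_O :: "real \<Rightarrow> real \<Rightarrow> real" where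
  "soft_O \<alpha> X = 10000 / (1 - \<alpha>) ^ 3 * (X * (1 + ln X))"

end

theory Submission
  imports Defs
begin

text \<open>Let \<open>\<lambda>\<^sub>*\<close> be the multiplier of least norm. The gradient test makes every outer iterate an
  \<open>\<epsilon>\<^sub>k\<close>-minimiser of the Lagrangian at the \<^emph>\<open>updated\<close> multiplier, so, testing it against the primal
  solution and using \<open>\<lambda>\<^sub>*\<close>, one gets
  \<open>|\<lambda>' - \<lambda>\<^sub>*|\<^sup>2 + |\<lambda>' - \<lambda>|\<^sup>2 \<le> |\<lambda> - \<lambda>\<^sub>*|\<^sup>2 + 2 \<rho> \<epsilon>\<^sub>k\<close>. With \<open>\<rho> = 1/\<delta>\<close> the last term is
  \<open>\<alpha>\<^sup>k + 1/2\<close>, whereas \<open>|\<lambda>' - \<lambda>| = \<rho> |A x' - b| > 1\<close> as long as the method does not stop; hence it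
  stops after at most \<open>2 R\<^sup>2 + 2/(1 - \<alpha>) + 1\<close> outer iterations, and the multipliers stay bounded,
  which controls the objective gap.

  For the inner method with composite objective \<open>\<psi> = g + h\<close>, the potential
  \<open>S\<^sub>j (\<psi>(q\<^sub>j) - \<psi>(u)) + \<tau>\<^sub>j/2 |u - p\<^sub>j|\<^sup>2\<close> decreases in
  iteration \<open>j\<close> by at least \<open>L/2 S\<close> times the squared prox residual, where \<open>S = S\<^bsub>j+1\<^esub>\<close> grows
  geometrically with ratio \<open>(1 + sqrt (\<mu>/2L)/2)\<^sup>2\<close>. The residual, and with it the gradient mapping, is
  therefore small after \<open>O(sqrt (L/\<mu>) log (L/\<mu>))\<close> iterations.\<close>

section \<open>Smooth functions\<close>

lemma gradient_eqI:
  fixes F :: "'a::real_inner \<Rightarrow> real"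
  assumes "GDERIV F x :> d"
  shows "gradient F x = d"
  unfolding gradient_def
proof (rule the_equality)
  fix d' assume "GDERIV F x :> d'"
  then have "(\<lambda>v. v \<bullet> d') = (\<lambda>v. v \<bullet> d)"
    using assms unfolding gderiv_def by (rule has_derivative_unique)
  from fun_cong[OF this, of "d' - d"] have "(d' - d) \<bullet> (d' - d) = 0"
    by (simp only: inner_diff_right right_minus_eq)
  then show "d' = d" by simp
qed (rule assms)

text \<open>The derivative is a linear functional, and its Riesz vector is its adjoint evaluated at
  1; so \<open>gradient\<close> is a genuine gradient at points of differentiability.\<close>

lemma GDERIV_gradient:
  fixes F :: "'a::euclidean_space \<Rightarrow> real"
  assumes "F differentiable (at x)"
  shows "GDERIV F x :> gradient F x"
proof -
  obtain F' where F': "(F has_derivative F') (at x)"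
    using assms unfolding differentiable_def by blast
  then have lin: "linear F'" by (simp add: has_derivative_linear)
  obtain d where d: "F' = (\<lambda>v. v \<bullet> d)"
  proof
    show "F' = (\<lambda>v. v \<bullet> adjoint F' 1)"
      by (rule ext) (simp only: adjoint_works[OF lin] inner_real_def mult_1_right)
  qed
  have "GDERIV F x :> d" using F' by (simp only: gderiv_def d)
  then show ?thesis by (simp only: gradient_eqI)
qed

lemma GDERIV_line:
  fixes F :: "'a::real_inner \<Rightarrow> real"
  assumes "GDERIV F (x + t *\<^sub>R v) :> d"
  shows "((\<lambda>t. F (x + t *\<^sub>R v)) has_real_derivative v \<bullet> d) (at t)"
proof -
  have F: "(F has_derivative (\<lambda>h. h \<bullet> d)) (at (x + t *\<^sub>R v))"
    using assms by (simp add: gderiv_def)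
  have l: "((\<lambda>t. x + t *\<^sub>R v) has_derivative (\<lambda>s. s *\<^sub>R v)) (at t)"
    by (auto intro!: derivative_eq_intros)
  show ?thesis
    using has_derivative_compose[OF l F] unfolding has_field_derivative_def
    by (rule has_derivative_eq_rhs) (simp add: fun_eq_iff)
qed

lemma smooth_convex_GDERIV:
  fixes f :: "'a::euclidean_space \<Rightarrow> real"
  shows "smooth_convex Lf f \<Longrightarrow> GDERIV f x :> gradient f x"
  by (simp add: smooth_convex_def GDERIV_gradient)

lemma smooth_convex_continuous:
  fixes f :: "'a::euclidean_space \<Rightarrow> real"
  assumes "smooth_convex Lf f"
  shows "continuous_on S f"
  using assms unfolding smooth_convex_def
  by (meson continuous_at_imp_continuous_on differentiable_imp_continuous_within)

text \<open>Along the segment from \<open>p\<close> to \<open>u\<close> the function is convex in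
  one variable and lies above its tangent at 0; the claim compares the two at 1.\<close>

lemma smooth_convex_lower:
  fixes f :: "'a::euclidean_space \<Rightarrow> real"
  assumes "smooth_convex Lf f"
  shows "f p + gradient f p \<bullet> (u - p) \<le> f u"
proof -
  let ?\<phi> = "\<lambda>t. f (p + t *\<^sub>R (u - p))"
  have cf: "convex_on UNIV f" using assms by (simp add: smooth_convex_def)
  have "convex_on UNIV ?\<phi>"
  proof (rule convex_onI)
    fix t x y :: real assume t: "0 < t" "t < 1"
    have "p + ((1 - t) *\<^sub>R x + t *\<^sub>R y) *\<^sub>R (u - p)
        = (1 - t) *\<^sub>R (p + x *\<^sub>R (u - p)) + t *\<^sub>R (p + y *\<^sub>R (u - p))"
      by (simp add: algebra_simps)
    then show "?\<phi> ((1 - t) *\<^sub>R x + t *\<^sub>R y) \<le> (1 - t) * ?\<phi> x + t * ?\<phi> y"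
      using convex_onD[OF cf, of t] t by simp
  qed simp
  moreover have "(?\<phi> has_real_derivative (u - p) \<bullet> gradient f p) (at 0)"
    using GDERIV_line[of f p 0 "u - p"] smooth_convex_GDERIV[OF assms, of p] by simp
  ultimately have "?\<phi> 1 - ?\<phi> 0 \<ge> ((u - p) \<bullet> gradient f p) * (1 - 0)"
    by (intro convex_on_imp_above_tangent[where A = UNIV and f = ?\<phi>])
      (auto intro: has_field_derivative_at_within)
  then show ?thesis by (simp add: inner_commute)
qed

text \<open>Descent lemma: subtracting the quadratic model along the segment leaves a function whose
  derivative on [0,1] is nonpositive, by Cauchy-Schwarz and the Lipschitz bound.\<close>

lemma smooth_convex_upper:
  fixes f :: "'a::euclidean_space \<Rightarrow> real"
  assumes "smooth_convex Lf f"
  shows "f u \<le> f p + gradient f p \<bullet> (u - p) + Lf / 2 * (norm (u - p))\<^sup>2"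
proof -
  define v where "v = u - p"
  let ?\<phi> = "\<lambda>t. f (p + t *\<^sub>R v) - t * (v \<bullet> gradient f p) - Lf / 2 * (norm v)\<^sup>2 * t\<^sup>2"
  have lip: "Lf-lipschitz_on UNIV (gradient f)" using assms by (simp add: smooth_convex_def)
  have "?\<phi> 0 \<ge> ?\<phi> 1"
  proof (rule DERIV_nonpos_imp_nonincreasing[where f = ?\<phi>])
    fix t :: real assume t: "0 \<le> t" "t \<le> 1"
    let ?d = "v \<bullet> gradient f (p + t *\<^sub>R v) - v \<bullet> gradient f p - Lf / 2 * (norm v)\<^sup>2 * (2 * t)"
    have "(?\<phi> has_real_derivative ?d) (at t)"
      using GDERIV_line[OF smooth_convex_GDERIV[OF assms]]
      by (auto intro!: derivative_eq_intros)
    moreover have "v \<bullet> (gradient f (p + t *\<^sub>R v) - gradient f p) \<le> norm v * (Lf * (t * norm v))"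
      using order_trans[OF norm_cauchy_schwarz mult_left_mono[OF lipschitz_onD[OF lip, of "p + t *\<^sub>R v" p, unfolded dist_norm]]] t
      by simp
    then have "?d \<le> 0" by (simp add: inner_diff_right power2_eq_square algebra_simps)
    ultimately show "\<exists>y. DERIV ?\<phi> t :> y \<and> y \<le> 0" by blast
  qed simp
  then show ?thesis by (simp add: v_def inner_commute)
qed

section \<open>Proper closed convex functions with bounded domain\<close>

text \<open>Passing to real values allows ordinary arithmetic. Where \<open>h\<close> is infinite
  the value is the meaningless default 0, so estimates come with membership in
  \<open>edom h\<close>.\<close>

abbreviation fin :: "('a \<Rightarrow> ereal) \<Rightarrow> 'a \<Rightarrow> real" where
  "fin h x \<equiv> real_of_ereal (h x)"

lemma ereal_fin:
  assumes "proper_closed_convex h" "x \<in> edom h"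
  shows "h x = ereal (fin h x)"
  using assms by (cases "h x") (auto simp: proper_closed_convex_def edom_def)

lemma le_ereal_iff_fin:
  assumes "proper_closed_convex h"
  shows "h x \<le> ereal r \<longleftrightarrow> x \<in> edom h \<and> fin h x \<le> r"
  using assms by (cases "h x") (auto simp: proper_closed_convex_def edom_def)

lemma convex_fin:
  assumes "proper_closed_convex h" "x \<in> edom h" "y \<in> edom h" "0 \<le> t" "t \<le> 1"
  shows "(1 - t) *\<^sub>R x + t *\<^sub>R y \<in> edom h"
    and "fin h ((1 - t) *\<^sub>R x + t *\<^sub>R y) \<le> (1 - t) * fin h x + t * fin h y"
proof -
  have "convex {(x, r::real). h x \<le> ereal r}" using assms by (simp add: proper_closed_convex_def)
  moreover have "(x, fin h x) \<in> {(x, r::real). h x \<le> ereal r}"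
      "(y, fin h y) \<in> {(x, r::real). h x \<le> ereal r}"
    using assms by (auto simp: le_ereal_iff_fin)
  ultimately have "(1 - t) *\<^sub>R (x, fin h x) + t *\<^sub>R (y, fin h y) \<in> {(x, r::real). h x \<le> ereal r}"
    by (rule convexD) (use assms in auto)
  then show "(1 - t) *\<^sub>R x + t *\<^sub>R y \<in> edom h"
    and "fin h ((1 - t) *\<^sub>R x + t *\<^sub>R y) \<le> (1 - t) * fin h x + t * fin h y"
    using assms by (auto simp: le_ereal_iff_fin)
qed

lemma convex_edom: "proper_closed_convex h \<Longrightarrow> convex (edom h)"
  unfolding convex_alt using convex_fin(1) by blast

text \<open>Weierstrass argument for a lower semicontinuous function: the sublevel sets
  \<open>T y\<close> are compact, and a minimiser over a finite set \<open>Y\<close> lies in every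
  \<open>T y\<close> with \<open>y\<close> in \<open>Y\<close>. By the finite intersection property
  some point lies in all of them.\<close>

lemma minimiser_exists:
  fixes h :: "'a::euclidean_space \<Rightarrow> ereal"
  assumes h: "proper_closed_convex h" and bd: "bounded (edom h)"
    and k: "continuous_on UNIV k" and C: "closed C" "C \<inter> edom h \<noteq> {}"
  obtains x where "x \<in> C \<inter> edom h"
    and "\<And>w. w \<in> C \<inter> edom h \<Longrightarrow> fin h x + k x \<le> fin h w + k w"
proof -
  define T where "T y = {x \<in> C \<inter> edom h. fin h x + k x \<le> fin h y + k y}" for y
  have comp: "compact (T y)" for y
  proof -
    \<comment> \<open>Within \<open>C\<close>, the sublevel set is the preimage of the closed
      epigraph under a continuous map.\<close>
    have T: "T y = C \<inter> (\<lambda>x. (x, fin h y + k y - k x)) -` {(x, r::real). h x \<le> ereal r}"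
      unfolding T_def by (auto simp: le_ereal_iff_fin[OF h])
    have "closed (T y)"
      unfolding T
    proof (intro closed_Int C closed_vimage)
      show "closed {(x, r::real). h x \<le> ereal r}" using h by (simp add: proper_closed_convex_def)
    qed (intro continuous_intros k)
    moreover have "bounded (T y)" using bd by (rule bounded_subset) (auto simp: T_def)
    ultimately show ?thesis by (simp add: compact_eq_bounded_closed)
  qed
  have fip: "\<Inter>\<F> \<noteq> {}" if sub: "finite \<F>" "\<F> \<subseteq> T ` (C \<inter> edom h)" for \<F>
  proof (cases "\<F> = {}")
    case False
    obtain Y where Y: "Y \<subseteq> C \<inter> edom h" "finite Y" "\<F> = T ` Y"
      using finite_subset_image[OF sub] by (elim exE conjE) (rule that)
    then have "Y \<noteq> {}" using False by auto
    then obtain m where m: "is_arg_min (\<lambda>y. fin h y + k y) (\<lambda>y. y \<in> Y) m"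
      using ex_is_arg_min_if_finite[OF Y(2)] by blast
    then have "m \<in> T y" if "y \<in> Y" for y
      using that Y(1) unfolding T_def is_arg_min_linorder by blast
    then show ?thesis unfolding Y(3) by blast
  qed simp
  have "\<Inter>(T ` (C \<inter> edom h)) \<noteq> {}"
  proof (rule compact_fip_Heine_Borel)
    show "compact S" if "S \<in> T ` (C \<inter> edom h)" for S using that comp by (elim imageE) simp
  qed (rule fip)
  then obtain x where x: "\<And>y. y \<in> C \<inter> edom h \<Longrightarrow> x \<in> T y" by blast
  moreover from C(2) obtain y where "y \<in> C \<inter> edom h" by blast
  then have "x \<in> C \<inter> edom h" using x[of y] by (simp add: T_def)
  ultimately show thesis using that[of x] by (simp add: T_def)
qed

text \<open>Serves both \<open>prox\<close> and the inner subproblem: since a minimiser exists, the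
  point chosen by \<open>arg_min\<close> is one, and its minimality becomes an inequality between
  reals.\<close>

lemma arg_min_composite:
  fixes h :: "'a::euclidean_space \<Rightarrow> ereal"
  assumes h: "proper_closed_convex h" and bd: "bounded (edom h)"
    and k: "continuous_on UNIV k" and a: "0 < a"
    and F: "\<And>u. F u = ereal a * h u + ereal (k u)"
  shows "arg_min F (\<lambda>_. True) \<in> edom h"
    and "w \<in> edom h \<Longrightarrow> a * fin h (arg_min F (\<lambda>_. True)) + k (arg_min F (\<lambda>_. True)) \<le> a * fin h w + k w"
proof -
  have ne: "UNIV \<inter> edom h \<noteq> {}" using h by (auto simp: proper_closed_convex_def)
  have Fin: "F u = ereal (a * fin h u + k u)" if "u \<in> edom h" for u
    unfolding F by (subst ereal_fin[OF h that]) simp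
  have Finf: "F u = \<infinity>" if "u \<notin> edom h" for u
    using F[of u] that a by (simp add: edom_def)
  have "continuous_on UNIV (\<lambda>u. k u / a)" using k a by (intro continuous_intros) auto
  then obtain x where x: "x \<in> edom h"
      "\<And>w. w \<in> edom h \<Longrightarrow> fin h x + k x / a \<le> fin h w + k w / a"
    using minimiser_exists[OF h bd _ closed_UNIV ne] by auto
  have "is_arg_min F (\<lambda>_. True) x"
    unfolding is_arg_min_linorder
  proof (intro conjI allI impI TrueI)
    fix w
    show "F x \<le> F w"
    proof (cases "w \<in> edom h")
      case True
      then have "a * (fin h x + k x / a) \<le> a * (fin h w + k w / a)"
        using x(2) a by (intro mult_left_mono) auto
      then show ?thesis using True x(1) a by (simp add: Fin algebra_simps)
    qed (simp add: Finf)
  qed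
  then have m: "is_arg_min F (\<lambda>_. True) (arg_min F (\<lambda>_. True))"
    unfolding arg_min_def by (rule someI)
  then have le: "F (arg_min F (\<lambda>_. True)) \<le> F w" for w by (simp add: is_arg_min_linorder)
  show *: "arg_min F (\<lambda>_. True) \<in> edom h"
    using le[of x] Fin[OF x(1)] Finf[of "arg_min F (\<lambda>_. True)"] by (metis ereal_infty_less_eq(1) PInfty_neq_ereal(1))
  show "a * fin h (arg_min F (\<lambda>_. True)) + k (arg_min F (\<lambda>_. True)) \<le> a * fin h w + k w"
    if "w \<in> edom h"
    using le[of w] Fin[OF *] Fin[OF that] by simp
qed

text \<open>The inequality says that \<open>a (z - u)\<close> is a subgradient of \<open>h\<close> at \<open>u\<close>.\<close>

definition prox_point :: "('a::real_inner \<Rightarrow> ereal) \<Rightarrow> real \<Rightarrow> 'a \<Rightarrow> 'a \<Rightarrow> bool" where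
  "prox_point h a z u \<longleftrightarrow>
     u \<in> edom h \<and> (\<forall>w\<in>edom h. fin h u + a * ((z - u) \<bullet> (w - u)) \<le> fin h w)"

text \<open>First-order optimality: compare \<open>u\<close> with the point at fraction t of the
  segment to \<open>w\<close>, use convexity of \<open>h\<close> and divide by t. The quadratic
  remainder is then of order t and vanishes in the limit.\<close>

lemma prox_pointI:
  fixes h :: "'a::euclidean_space \<Rightarrow> ereal"
  assumes h: "proper_closed_convex h" and u: "u \<in> edom h" and a: "0 < a"
    and min: "\<And>w. w \<in> edom h \<Longrightarrow>
      fin h u + a / 2 * (norm (u - z))\<^sup>2 \<le> fin h w + a / 2 * (norm (w - z))\<^sup>2"
  shows "prox_point h a z u"
  unfolding prox_point_def
proof (intro conjI ballI u)
  fix w assume w: "w \<in> edom h"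
  let ?c = "a / 2 * (norm (w - u))\<^sup>2"
  have le: "fin h u + a * ((z - u) \<bullet> (w - u)) - t * ?c \<le> fin h w" if t: "0 < t" "t \<le> 1" for t
  proof -
    let ?x = "(1 - t) *\<^sub>R u + t *\<^sub>R w"
    have x: "?x \<in> edom h" "fin h ?x \<le> (1 - t) * fin h u + t * fin h w"
      using convex_fin[OF h u w] t by auto
    have "?x - z = (u - z) + t *\<^sub>R (w - u)" by (simp add: algebra_simps)
    then have "(norm (?x - z))\<^sup>2
        = (norm (u - z))\<^sup>2 - 2 * t * ((z - u) \<bullet> (w - u)) + t\<^sup>2 * (norm (w - u))\<^sup>2"
      by (simp only: power2_norm_eq_inner)
        (simp add: inner_commute algebra_simps power2_eq_square)
    then have "a / 2 * (norm (?x - z))\<^sup>2 = a / 2 * (norm (u - z))\<^sup>2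
        - t * (a * ((z - u) \<bullet> (w - u))) + t * (t * ?c)"
      by (simp only: distrib_left right_diff_distrib power2_eq_square) simp
    then have "fin h u \<le> (1 - t) * fin h u + t * fin h w
        - t * (a * ((z - u) \<bullet> (w - u))) + t * (t * ?c)"
      using min[OF x(1)] x(2) by linarith
    then have "t * (fin h u + a * ((z - u) \<bullet> (w - u)) - t * ?c) \<le> t * fin h w"
      by (simp add: algebra_simps)
    then show ?thesis using t by simp
  qed
  have "((\<lambda>t. fin h u + a * ((z - u) \<bullet> (w - u)) - t * ?c)
      \<longlongrightarrow> fin h u + a * ((z - u) \<bullet> (w - u)) - 0 * ?c) (at_right 0)"
    by (intro tendsto_intros)
  moreover have "eventually (\<lambda>t. fin h u + a * ((z - u) \<bullet> (w - u)) - t * ?c \<le> fin h w) (at_right 0)"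
    unfolding eventually_at_right_field by (rule exI[of _ 1]) (use le in auto)
  ultimately show "fin h u + a * ((z - u) \<bullet> (w - u)) \<le> fin h w"
    using tendsto_upperbound by fastforce
qed

lemma prox_point_prox:
  fixes h :: "'a::euclidean_space \<Rightarrow> ereal"
  assumes h: "proper_closed_convex h" and bd: "bounded (edom h)" and \<eta>: "0 < \<eta>"
  shows "prox_point h (1 / \<eta>) z (prox \<eta> h z)"
proof -
  have k: "continuous_on UNIV (\<lambda>y. (norm (z - y))\<^sup>2 / 2)" by (intro continuous_intros) auto
  note m = arg_min_composite[OF h bd k \<eta> refl, folded prox_def]
  show ?thesis
  proof (rule prox_pointI[OF h m(1)])
    fix w assume "w \<in> edom h"
    then have "1 / \<eta> * (\<eta> * fin h (prox \<eta> h z) + (norm (z - prox \<eta> h z))\<^sup>2 / 2)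
        \<le> 1 / \<eta> * (\<eta> * fin h w + (norm (z - w))\<^sup>2 / 2)"
      using m(2)[of w] \<eta> by (intro mult_left_mono) auto
    then show "fin h (prox \<eta> h z) + 1 / \<eta> / 2 * (norm (prox \<eta> h z - z))\<^sup>2
        \<le> fin h w + 1 / \<eta> / 2 * (norm (w - z))\<^sup>2"
      using \<eta> by (simp add: field_simps norm_minus_commute)
  qed (use \<eta> in simp)
qed

text \<open>Monotonicity of the subdifferential: testing each subgradient inequality at the other
  point and adding gives firm nonexpansiveness; Cauchy-Schwarz does the rest.\<close>

lemma prox_point_nonexpansive:
  assumes "prox_point h a z u" "prox_point h a z' u'" "0 < a"
  shows "norm (u - u') \<le> norm (z - z')"
proof -
  have "a * ((z - u) \<bullet> (u' - u)) + a * ((z' - u') \<bullet> (u - u')) \<le> 0"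
    using assms unfolding prox_point_def by (smt (verit, best))
  then have "a * ((z - u) \<bullet> (u' - u) + (z' - u') \<bullet> (u - u')) \<le> 0" by (simp add: algebra_simps)
  then have "(z - u) \<bullet> (u' - u) + (z' - u') \<bullet> (u - u') \<le> 0"
    using assms(3) by (simp add: mult_le_0_iff)
  then have "(norm (u - u'))\<^sup>2 \<le> (z - z') \<bullet> (u - u')"
    by (simp add: power2_norm_eq_inner inner_commute algebra_simps)
  also have "\<dots> \<le> norm (z - z') * norm (u - u')" by (rule norm_cauchy_schwarz)
  finally show ?thesis
    by (cases "u = u'") (auto simp: power2_eq_square)
qed

section \<open>The accelerated composite gradient method\<close>

text \<open>Sum of the subgradient inequality of \<open>h\<close> at \<open>q\<close>, the strong
  convexity of \<open>g\<close> at \<open>p\<close> and the descent bound. The step parameter 2 L +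
  \<mu> exceeds the smoothness constant L + \<mu> by L; this excess later leaves a multiple L/2 of
  the squared residual.\<close>

lemma composite_model:
  fixes h :: "'a::euclidean_space \<Rightarrow> ereal" and p q u v :: 'a
  assumes a: "0 < 2 * L + \<mu>"
    and q: "prox_point h (2 * L + \<mu>) (p - (1 / (2 * L + \<mu>)) *\<^sub>R v) q"
    and u: "u \<in> edom h"
    and lower: "g p + v \<bullet> (u - p) + \<mu> / 2 * (norm (u - p))\<^sup>2 \<le> g u"
    and upper: "g q \<le> g p + v \<bullet> (q - p) + (L + \<mu>) / 2 * (norm (q - p))\<^sup>2"
  shows "g q + fin h q - L / 2 * (norm (p - q))\<^sup>2 + 2 * L * ((p - q) \<bullet> (u - q))
      + \<mu> / 2 * (norm (u - q))\<^sup>2 \<le> g u + fin h u"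
proof -
  define X V W where "X = (p - q) \<bullet> (u - q)" and "V = v \<bullet> (u - q)" and "W = v \<bullet> (q - p)"
  have "(2 * L + \<mu>) * ((p - (1 / (2 * L + \<mu>)) *\<^sub>R v - q) \<bullet> (u - q)) = (2 * L + \<mu>) * X - V"
    using a by (simp add: inner_diff_left right_diff_distrib X_def V_def)
  then have 1: "fin h q + ((2 * L + \<mu>) * X - V) \<le> fin h u"
    using q u unfolding prox_point_def by metis
  have "v \<bullet> (u - p) = V + W" by (simp add: inner_diff_right V_def W_def)
  moreover have "(norm (u - p))\<^sup>2 = (norm (u - q))\<^sup>2 - 2 * X + (norm (p - q))\<^sup>2"
    by (simp add: X_def power2_norm_eq_inner inner_commute algebra_simps)
  ultimately have 2: "g p + (V + W)
      + \<mu> / 2 * ((norm (u - q))\<^sup>2 - 2 * X + (norm (p - q))\<^sup>2) \<le> g u"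
    using lower by metis
  have 3: "g q \<le> g p + W + (L + \<mu>) / 2 * (norm (p - q))\<^sup>2"
    using upper unfolding W_def norm_minus_commute[of p q] .
  show ?thesis
    unfolding X_def[symmetric] using 1 2 3 by (simp add: field_simps)
qed

text \<open>\<open>p'\<close> minimises the quadratic on the right without its last term, whose
  modulus is \<open>\<tau>'\<close>. The expansion around \<open>p'\<close> is exact, and completing
  a square bounds the minimum from below by the negative of the last term.\<close>

lemma acg_prox_step:
  fixes p p' q u d :: "'a::real_inner"
  assumes \<tau>: "0 < \<tau>" and \<tau>': "\<tau>' = \<tau> + m" and m: "0 \<le> m"
    and p': "\<tau>' *\<^sub>R p' = \<tau> *\<^sub>R p + m *\<^sub>R q - c *\<^sub>R d"
  shows "\<tau>' / 2 * (norm (u - p'))\<^sup>2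
    \<le> \<tau> / 2 * (norm (u - p))\<^sup>2 + m / 2 * (norm (u - q))\<^sup>2 + c * (d \<bullet> (u - p)) + c\<^sup>2 / (2 * \<tau>) * (norm d)\<^sup>2"
proof -
  define a y e where "a = u - p" and "y = p' - p" and "e = q - p"
  have "\<tau>' *\<^sub>R y = m *\<^sub>R e - c *\<^sub>R d"
    using p' by (simp add: \<tau>' y_def e_def algebra_simps)
  \<comment> \<open>Stationarity of the quadratic at \<open>p'\<close>, paired with u - p' = a -
    y.\<close>
  then have "(\<tau>' *\<^sub>R y) \<bullet> (a - y) = (m *\<^sub>R e - c *\<^sub>R d) \<bullet> (a - y)" by simp
  then have "\<tau> / 2 * (a \<bullet> a) + m / 2 * ((a - e) \<bullet> (a - e)) + c * (d \<bullet> a)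
      = \<tau> / 2 * (y \<bullet> y) + m / 2 * ((y - e) \<bullet> (y - e)) + c * (d \<bullet> y) + \<tau>' / 2 * ((a - y) \<bullet> (a - y))"
    unfolding \<tau>' by (simp add: inner_commute algebra_simps add_divide_distrib)
  moreover have "0 \<le> m / 2 * ((y - e) \<bullet> (y - e))" using m by simp
  moreover have "0 \<le> 1 / (2 * \<tau>) * ((\<tau> *\<^sub>R y + c *\<^sub>R d) \<bullet> (\<tau> *\<^sub>R y + c *\<^sub>R d))"
    using \<tau> by simp
  moreover have "1 / (2 * \<tau>) * ((\<tau> *\<^sub>R y + c *\<^sub>R d) \<bullet> (\<tau> *\<^sub>R y + c *\<^sub>R d))
      = \<tau> / 2 * (y \<bullet> y) + c * (d \<bullet> y) + c\<^sup>2 / (2 * \<tau>) * (d \<bullet> d)"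
    using \<tau> unfolding inner_add_left inner_add_right inner_scaleR_left inner_scaleR_right
    by (simp add: inner_commute[of y d] power2_eq_square field_simps)
  moreover have au: "u - q = a - e" "u - p' = a - y" "u - p = a" by (simp_all add: a_def e_def y_def)
  ultimately show ?thesis unfolding power2_norm_eq_inner au by linarith
qed

text \<open>\<open>lower\<close> and \<open>upper\<close> are \<mu>-strong convexity and (L +
  \<mu>)-smoothness as quadratic bounds around the linearisation, the form in which the analysis
  uses them.\<close>

locale composite =
  fixes g :: "'a::euclidean_space \<Rightarrow> real" and h :: "'a \<Rightarrow> ereal" and L \<mu> :: real
  assumes h: "proper_closed_convex h" and bd: "bounded (edom h)"
    and L: "0 < L" and \<mu>: "0 < \<mu>"
    and lower: "g p + gradient g p \<bullet> (u - p) + \<mu> / 2 * (norm (u - p))\<^sup>2 \<le> g u"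
    and upper: "g u \<le> g p + gradient g p \<bullet> (u - p) + (L + \<mu>) / 2 * (norm (u - p))\<^sup>2"
begin

lemma objective_fin: "x \<in> edom h \<Longrightarrow> objective g h x = ereal (g x + fin h x)"
  unfolding objective_def by (subst ereal_fin[OF h]) simp_all

text \<open>Completing the square turns the linearised model, up to a constant, into one quadratic
  centred at the gradient step, so its minimiser is a proximal point.\<close>

lemma acg_qt_prox_point:
  "prox_point h (2 * L + \<mu>)
     (acg_pt L st - (1 / (2 * L + \<mu>)) *\<^sub>R gradient g (acg_pt L st)) (acg_qt g h L \<mu> st)"
proof -
  define p v a where "p = acg_pt L st" and "v = gradient g p" and "a = 2 * L + \<mu>"
  have a: "0 < a" using L \<mu> by (simp add: a_def)
  let ?F = "\<lambda>u. ereal (g p + v \<bullet> (u - p)) + h u + ereal (a / 2 * (norm (u - p))\<^sup>2)"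
  let ?k = "\<lambda>u. g p + v \<bullet> (u - p) + a / 2 * (norm (u - p))\<^sup>2"
  have k: "continuous_on UNIV ?k" by (intro continuous_intros)
  have F: "?F u = ereal 1 * h u + ereal (?k u)" for u
    by (cases "h u") (auto simp: one_ereal_def[symmetric])
  note m = arg_min_composite[OF h bd k zero_less_one F]
  have k_eq: "?k w = a / 2 * (norm (w - (p - (1 / a) *\<^sub>R v)))\<^sup>2 + (g p - (v \<bullet> v) / (2 * a))" for w
  proof -
    have "w - (p - (1 / a) *\<^sub>R v) = (w - p) + (1 / a) *\<^sub>R v" by simp
    then have "(norm (w - (p - (1 / a) *\<^sub>R v)))\<^sup>2
        = (norm (w - p))\<^sup>2 + 2 / a * (v \<bullet> (w - p)) + (v \<bullet> v) / a\<^sup>2"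
      by (simp only: power2_norm_eq_inner inner_add_left inner_add_right)
        (simp add: inner_commute power2_eq_square field_simps)
    then show ?thesis using a by (simp add: field_simps power2_eq_square)
  qed
  have "prox_point h a (p - (1 / a) *\<^sub>R v) (arg_min ?F (\<lambda>_. True))"
  proof (rule prox_pointI[OF h m(1) a])
    fix w assume "w \<in> edom h"
    from m(2)[OF this] show "fin h (arg_min ?F (\<lambda>_. True))
        + a / 2 * (norm (arg_min ?F (\<lambda>_. True) - (p - (1 / a) *\<^sub>R v)))\<^sup>2
      \<le> fin h w + a / 2 * (norm (w - (p - (1 / a) *\<^sub>R v)))\<^sup>2"
      unfolding k_eq by simp
  qed
  then show ?thesis by (simp add: acg_qt_def p_def v_def a_def Let_def)
qed

text \<open>The potential decreases because the model inequality is used at the old \<open>q\<close>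
  with weight S and at \<open>u\<close> with weight s, and the new \<open>p\<close> is the minimiser
  that absorbs the resulting linear term. The growth of S follows from the quadratic equation for
  s.\<close>

lemma acg_step_potential:
  fixes t :: bool
  assumes S: "0 \<le> acg_S st" and \<tau>: "acg_tau st = 1 + \<mu> * acg_S st"
    and q: "acg_q st \<in> edom h" and u: "u \<in> edom h"
  defines "st' \<equiv> acg_step g h L \<mu> t st"
  shows "acg_tau st' = 1 + \<mu> * acg_S st'"
    and "acg_q st' \<in> edom h"
    and "0 < acg_S st'" and "1 / (2 * L) \<le> acg_S st'"
    and "(1 + sqrt (\<mu> / (2 * L)) / 2)\<^sup>2 * acg_S st \<le> acg_S st'"
    and "acg_S st' * (g (acg_q st') + fin h (acg_q st') - (g u + fin h u))
        + acg_tau st' / 2 * (norm (u - acg_p st'))\<^sup>2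
        + L / 2 * acg_S st' * (norm (acg_pt L st - acg_qt g h L \<mu> st))\<^sup>2
      \<le> acg_S st * (g (acg_q st) + fin h (acg_q st) - (g u + fin h u))
        + acg_tau st / 2 * (norm (u - acg_p st))\<^sup>2"
proof -
  define S s S' p q pt qt \<tau> where "S = acg_S st" and "s = acg_s L st" and "S' = S + s"
    and "p = acg_p st" and "q = acg_q st" and "pt = acg_pt L st" and "qt = acg_qt g h L \<mu> st"
    and "\<tau> = acg_tau st"
  note defs = S_def s_def S'_def p_def q_def pt_def qt_def \<tau>_def
  define q' p' where "q' = (if objective g h qt < objective g h q \<or> objective g h qt = objective g h q \<and> t
      then qt else q)"
    and "p' = (1 / (S' * \<mu> + 1)) *\<^sub>R (((2 * L + \<mu>) * s) *\<^sub>R qt - (2 * S * s * L / S') *\<^sub>R q)"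
  have st': "st' = ACG_State S' (\<tau> + \<mu> * s) p' q'"
    by (simp add: st'_def acg_step_def Let_def defs q'_def p'_def)
  have S0: "0 \<le> S" and \<tau>1: "\<tau> = 1 + \<mu> * S" using S \<tau> by (simp_all add: defs)
  then have \<tau>ge: "1 \<le> \<tau>" using \<mu> by simp
  let ?r = "sqrt (\<tau>\<^sup>2 + 8 * \<tau> * S * L)"
  have s: "s = (\<tau> + ?r) / (4 * L)" by (simp add: defs acg_s_def)
  have r2: "?r\<^sup>2 = \<tau>\<^sup>2 + 8 * \<tau> * S * L" using \<tau>ge S0 L by simp
  have r_ge: "\<tau> \<le> ?r" using \<tau>ge S0 L by (intro real_le_rsqrt) simp
  \<comment> \<open>\<open>s\<close> is the positive root of 2 L s^2 = \<tau> (S + s); this equation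
    drives both the growth of S and the cancellation in the potential.\<close>
  have "?r = 4 * L * s - \<tau>" using L by (simp add: s)
  then have "(4 * L * s - \<tau>)\<^sup>2 = \<tau>\<^sup>2 + 8 * \<tau> * S * L" using r2 by simp
  then have "8 * L * (2 * L * s\<^sup>2) = 8 * L * (\<tau> * (S + s))"
    by (simp add: power2_eq_square algebra_simps)
  then have quad: "2 * L * s\<^sup>2 = \<tau> * S'" using L by (simp add: S'_def)
  have "2 / (4 * L) \<le> s" unfolding s using \<tau>ge r_ge L by (intro divide_right_mono) auto
  then have sge: "1 / (2 * L) \<le> s" using L by (simp add: field_simps)
  moreover have "0 < 1 / (2 * L)" using L by simp
  ultimately have spos: "0 < s" by linarith
  have S'pos: "0 < S'" using S0 spos by (simp add: S'_def)
  have \<tau>': "\<tau> + \<mu> * s = 1 + \<mu> * S'" by (simp add: \<tau>1 S'_def algebra_simps)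
  show "acg_tau st' = 1 + \<mu> * acg_S st'" by (simp add: st' \<tau>')
  show "0 < acg_S st'" by (simp add: st' S'pos)
  show "1 / (2 * L) \<le> acg_S st'" using sge S0 by (simp add: st' S'_def)

  have q_dom: "q \<in> edom h" using q by (simp add: defs)
  note prox = acg_qt_prox_point[of st, folded pt_def qt_def]
  then have qt_dom: "qt \<in> edom h" by (simp add: prox_point_def)
  show "acg_q st' \<in> edom h" using q_dom qt_dom by (simp add: st' q'_def)
  have q'_le: "g q' + fin h q' \<le> g qt + fin h qt"
    using objective_fin[OF q_dom] objective_fin[OF qt_dom] by (auto simp: q'_def)

  \<comment> \<open>The growth is seen on square roots: \<tau> \<ge> \<mu> S in the quadratic
    equation gives s \<ge> c sqrt (S S'), while s = S' - S is a difference of squares of these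
    roots.\<close>
  show "(1 + sqrt (\<mu> / (2 * L)) / 2)\<^sup>2 * acg_S st \<le> acg_S st'"
  proof -
    define c r r' where "c = sqrt (\<mu> / (2 * L))" and "r = sqrt S" and "r' = sqrt S'"
    have c2: "c\<^sup>2 = \<mu> / (2 * L)" and r2: "r\<^sup>2 = S" and r'2: "r'\<^sup>2 = S'"
      using L \<mu> S0 S'pos by (simp_all add: c_def r_def r'_def)
    have pos: "0 \<le> c" "0 \<le> r" "0 < r'" "r \<le> r'"
      using L \<mu> S0 S'pos spos by (simp_all add: c_def r_def r'_def S'_def)
    have "\<mu> * S * S' \<le> \<tau> * S'" using S'pos by (simp add: \<tau>1)
    then have "\<mu> / (2 * L) * S * S' \<le> s\<^sup>2" using quad L by (simp add: field_simps)
    then have "(c * r * r')\<^sup>2 \<le> s\<^sup>2" by (simp add: power_mult_distrib c2 r2 r'2)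
    then have "c * r * r' \<le> s" using spos by (rule power2_le_imp_le[OF _ less_imp_le])
    also have "s = r'\<^sup>2 - r\<^sup>2" by (simp add: r2 r'2 S'_def)
    also have "\<dots> = (r' - r) * (r' + r)" by (simp add: power2_eq_square algebra_simps)
    also have "\<dots> \<le> (r' - r) * (2 * r')" using pos by (intro mult_left_mono) auto
    finally have "r' * (c * r) \<le> r' * (2 * (r' - r))" by (simp add: algebra_simps)
    then have "c * r \<le> 2 * (r' - r)" using pos by simp
    then have "(1 + c / 2) * r \<le> r'" by (simp add: algebra_simps)
    then have "((1 + c / 2) * r)\<^sup>2 \<le> r'\<^sup>2" using pos by (intro power_mono) auto
    then show ?thesis by (simp add: power_mult_distrib r2 r'2 st' c_def S_def)
  qed

  let ?\<psi> = "\<lambda>x. g x + fin h x"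
  define d where "d = pt - qt"
  have a: "0 < 2 * L + \<mu>" using L \<mu> by simp
  have model: "?\<psi> qt - L / 2 * (norm d)\<^sup>2 + 2 * L * (d \<bullet> (w - qt)) + \<mu> / 2 * (norm (w - qt))\<^sup>2 \<le> ?\<psi> w"
    if "w \<in> edom h" for w
    using composite_model[OF a prox that lower upper] by (simp add: d_def)
  have pt: "S' *\<^sub>R pt = S *\<^sub>R q + s *\<^sub>R p"
    using S'pos by (simp add: defs acg_pt_def Let_def scaleR_add_right)
  \<comment> \<open>At \<open>q\<close> the strong convexity term is dropped; at \<open>u\<close> it
    is kept, to pay for the increase of \<tau>.\<close>
  have "S * (?\<psi> qt - L / 2 * (norm d)\<^sup>2 + 2 * L * (d \<bullet> (q - qt))) \<le> S * ?\<psi> q"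
  proof (rule mult_left_mono[OF _ S0])
    have "0 \<le> \<mu> / 2 * (norm (q - qt))\<^sup>2" using \<mu> by simp
    then show "?\<psi> qt - L / 2 * (norm d)\<^sup>2 + 2 * L * (d \<bullet> (q - qt)) \<le> ?\<psi> q"
      using model[OF q_dom] by linarith
  qed
  moreover have "s * (?\<psi> qt - L / 2 * (norm d)\<^sup>2 + 2 * L * (d \<bullet> (u - qt)) + \<mu> / 2 * (norm (u - qt))\<^sup>2)
      \<le> s * ?\<psi> u"
    using spos by (intro mult_left_mono model[OF u]) auto
  \<comment> \<open>As \<open>pt\<close> is the weighted mean of \<open>q\<close> and
    \<open>p\<close>, the two linear terms combine into one against u - p plus S' times the squared
    residual.\<close>
  moreover have "S * (d \<bullet> (q - qt)) + s * (d \<bullet> (u - qt)) = s * (d \<bullet> (u - p)) + S' * (norm d)\<^sup>2"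
  proof -
    have "S *\<^sub>R (q - qt) + s *\<^sub>R (u - qt) = s *\<^sub>R (u - p) + S' *\<^sub>R d"
      using pt by (simp add: d_def S'_def algebra_simps)
    then have "d \<bullet> (S *\<^sub>R (q - qt) + s *\<^sub>R (u - qt)) = d \<bullet> (s *\<^sub>R (u - p) + S' *\<^sub>R d)" by simp
    then show ?thesis by (simp add: inner_add_right power2_norm_eq_inner)
  qed
  then have "2 * L * (S * (d \<bullet> (q - qt)) + s * (d \<bullet> (u - qt)))
      = 2 * L * (s * (d \<bullet> (u - p)) + S' * (norm d)\<^sup>2)" by simp
  moreover have c2: "(2 * L * s)\<^sup>2 / (2 * \<tau>) = L * S'"
  proof -
    have "(2 * L * s)\<^sup>2 = 2 * L * (2 * L * s\<^sup>2)" by (simp add: power2_eq_square)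
    then show ?thesis using \<tau>ge by (simp add: quad)
  qed
  \<comment> \<open>\<open>acg_prox_step\<close> with m = \<mu> s and c = 2 L s; by the quadratic
    equation its last coefficient is L S'.\<close>
  have "(\<tau> + \<mu> * s) / 2 * (norm (u - p'))\<^sup>2
    \<le> \<tau> / 2 * (norm (u - p))\<^sup>2 + (\<mu> * s) / 2 * (norm (u - qt))\<^sup>2 + (2 * L * s) * (d \<bullet> (u - p))
      + L * S' * (norm d)\<^sup>2"
    unfolding c2[symmetric]
  proof (rule acg_prox_step)
    have "(\<tau> + \<mu> * s) *\<^sub>R p' = ((2 * L + \<mu>) * s) *\<^sub>R qt - (2 * S * s * L / S') *\<^sub>R q"
    proof -
      have "0 < \<mu> * S'" using \<mu> S'pos by simp
      then have "S' * \<mu> + 1 = \<tau> + \<mu> * s" "\<tau> + \<mu> * s \<noteq> 0"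
        using \<tau>' by (simp_all add: mult.commute)
      then show ?thesis by (simp add: p'_def)
    qed
    \<comment> \<open>The update of \<open>p\<close> is written with \<open>q\<close>; eliminating
      \<open>q\<close> through \<open>pt\<close> brings it to the form of
      \<open>acg_prox_step\<close>.\<close>
    also have "\<dots> = \<tau> *\<^sub>R p + (\<mu> * s) *\<^sub>R qt - (2 * L * s) *\<^sub>R d"
    proof -
      have "\<tau> *\<^sub>R p = (2 * L * s) *\<^sub>R pt - (2 * S * s * L / S') *\<^sub>R q"
      proof -
        have "\<tau> = 2 * L * s\<^sup>2 / S'" using quad S'pos by (simp add: field_simps)
        then have "\<tau> *\<^sub>R p = (2 * L * s / S') *\<^sub>R (s *\<^sub>R p)" by (simp add: power2_eq_square)
        also have "s *\<^sub>R p = S' *\<^sub>R pt - S *\<^sub>R q" using pt by simp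
        finally show ?thesis using S'pos by (simp add: scaleR_diff_right ac_simps)
      qed
      then show ?thesis by (simp add: d_def algebra_simps)
    qed
    finally show "(\<tau> + \<mu> * s) *\<^sub>R p' = \<tau> *\<^sub>R p + (\<mu> * s) *\<^sub>R qt - (2 * L * s) *\<^sub>R d" .
  qed (use \<tau>ge \<mu> spos in auto)
  moreover have "S' * ?\<psi> q' \<le> S' * ?\<psi> qt" using S'pos q'_le by simp
  \<comment> \<open>The squared residual is collected with coefficient S' (2 L - L/2 - L) = S' L/2.
    Naming the inner products keeps them opaque to the arithmetic.\<close>
  moreover define N X Y Z where "N = (norm d)\<^sup>2" and "X = d \<bullet> (q - qt)"
    and "Y = d \<bullet> (u - qt)" and "Z = d \<bullet> (u - p)"
  ultimately have "S' * (?\<psi> q' - ?\<psi> u) + (\<tau> + \<mu> * s) / 2 * (norm (u - p'))\<^sup>2 + L / 2 * S' * (norm d)\<^sup>2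
      \<le> S * (?\<psi> q - ?\<psi> u) + \<tau> / 2 * (norm (u - p))\<^sup>2"
    unfolding S'_def N_def[symmetric] X_def[symmetric] Y_def[symmetric] Z_def[symmetric]
    by (simp add: algebra_simps add_divide_distrib)
  then show "acg_S st' * (g (acg_q st') + fin h (acg_q st') - (g u + fin h u))
        + acg_tau st' / 2 * (norm (u - acg_p st'))\<^sup>2
        + L / 2 * acg_S st' * (norm (acg_pt L st - acg_qt g h L \<mu> st))\<^sup>2
      \<le> acg_S st * (g (acg_q st) + fin h (acg_q st) - (g u + fin h u))
        + acg_tau st / 2 * (norm (u - acg_p st))\<^sup>2"
    unfolding st' d_def by (simp add: defs)
qed

section \<open>Iterating the one-step estimate\<close>

lemma acg_invariant:
  fixes tie :: "nat \<Rightarrow> bool" and j :: nat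
  assumes x: "x \<in> edom h" and u: "u \<in> edom h"
  defines "st \<equiv> acg tie g h L \<mu> x"
  shows "0 \<le> acg_S (st j) \<and> acg_tau (st j) = 1 + \<mu> * acg_S (st j) \<and> acg_q (st j) \<in> edom h
    \<and> acg_S (st j) * (g (acg_q (st j)) + fin h (acg_q (st j)) - (g u + fin h u))
        + acg_tau (st j) / 2 * (norm (u - acg_p (st j)))\<^sup>2 \<le> (norm (u - x))\<^sup>2 / 2"
proof (induction j)
  case 0
  then show ?case using x by (simp add: st_def)
next
  case (Suc j)
  have st: "st (Suc j) = acg_step g h L \<mu> (tie j) (st j)" by (simp add: st_def)
  note step = acg_step_potential[of "st j" u "tie j", folded st]
  have "0 \<le> L / 2 * acg_S (st (Suc j)) * (norm (acg_pt L (st j) - acg_qt g h L \<mu> (st j)))\<^sup>2"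
    using step(3) Suc u L by (intro mult_nonneg_nonneg) (auto intro: less_imp_le)
  then show ?case using step Suc u by (auto intro: less_imp_le)
qed

text \<open>The growth is multiplicative and S_0 = 0, so the induction is anchored at S_1 \<ge> 1/(2
  L); hence the shifted index.\<close>

lemma acg_S_growth:
  assumes x: "x \<in> edom h"
  shows "1 / (2 * L) * (1 + sqrt (\<mu> / (2 * L)) / 2) ^ (2 * j) \<le> acg_S (acg tie g h L \<mu> x (Suc j))"
proof (induction j)
  case 0
  show ?case using acg_step_potential(4)[of "acg tie g h L \<mu> x 0" x] x by simp
next
  case (Suc j)
  let ?c = "1 + sqrt (\<mu> / (2 * L)) / 2"
  have "1 / (2 * L) * ?c ^ (2 * Suc j) = ?c\<^sup>2 * (1 / (2 * L) * ?c ^ (2 * j))"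
    by (simp add: power2_eq_square)
  also have "\<dots> \<le> ?c\<^sup>2 * acg_S (acg tie g h L \<mu> x (Suc j))"
    using Suc by (intro mult_left_mono) auto
  also have "\<dots> \<le> acg_S (acg tie g h L \<mu> x (Suc (Suc j)))"
    using acg_step_potential(5)[of "acg tie g h L \<mu> x (Suc j)" x "tie (Suc j)"]
      acg_invariant[OF x x, of tie "Suc j"] x by (simp del: acg.simps(2) add: acg.simps(2)[of _ _ _ _ _ _ "Suc j"])
  finally show ?case .
qed

text \<open>With \<open>u\<close> a minimiser of \<psi>, both terms of the new potential are
  nonnegative, so the residual term alone is bounded by the initial potential, half the squared
  distance from \<open>x\<close> to \<open>u\<close>.\<close>

lemma acg_residual:
  fixes tie :: "nat \<Rightarrow> bool" and j :: nat
  assumes x: "x \<in> edom h" and k: "continuous_on UNIV g"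
    and D: "\<And>u v. u \<in> edom h \<Longrightarrow> v \<in> edom h \<Longrightarrow> norm (u - v) \<le> D"
  defines "st \<equiv> acg tie g h L \<mu> x j"
  shows "(norm (acg_pt L st - acg_qt g h L \<mu> st))\<^sup>2 * (1 + sqrt (\<mu> / (2 * L)) / 2) ^ (2 * j) \<le> 2 * D\<^sup>2"
proof -
  have "UNIV \<inter> edom h \<noteq> {}" using x by auto
  then obtain u where u: "u \<in> edom h"
    and min: "\<And>w. w \<in> edom h \<Longrightarrow> fin h u + g u \<le> fin h w + g w"
    using minimiser_exists[OF h bd k closed_UNIV] by auto
  define st' d where "st' = acg_step g h L \<mu> (tie j) st" and "d = norm (acg_pt L st - acg_qt g h L \<mu> st)"
  note inv = acg_invariant[OF x u, of tie j, folded st_def]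
  note step = acg_step_potential[of st u "tie j", folded st'_def]
  have "0 \<le> acg_S st' * (g (acg_q st') + fin h (acg_q st') - (g u + fin h u))"
    using step(2,3) inv u min[of "acg_q st'"] by (intro mult_nonneg_nonneg) auto
  moreover have "0 \<le> acg_tau st' / 2 * (norm (u - acg_p st'))\<^sup>2"
    using step(1,3) inv u \<mu> by auto
  ultimately have le: "L / 2 * acg_S st' * d\<^sup>2 \<le> (norm (u - x))\<^sup>2 / 2"
    using step(6) inv u by (auto simp: d_def)
  \<comment> \<open>The factor 4 inverts L/2 times the starting value 1/(2 L) in the growth
    bound.\<close>
  have "d\<^sup>2 * (1 + sqrt (\<mu> / (2 * L)) / 2) ^ (2 * j)
      = (L / 2 * (1 / (2 * L) * (1 + sqrt (\<mu> / (2 * L)) / 2) ^ (2 * j)) * d\<^sup>2) * 4"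
    using L by simp
  also have "\<dots> \<le> (L / 2 * acg_S st' * d\<^sup>2) * 4"
    using acg_S_growth[OF x, of j tie] L
    by (intro mult_right_mono mult_left_mono) (auto simp: st'_def st_def)
  also have "\<dots> \<le> 2 * (norm (u - x))\<^sup>2" using le by simp
  also have "\<dots> \<le> 2 * D\<^sup>2" using power_mono[OF D[OF u x] norm_ge_zero] by simp
  finally show ?thesis by (simp add: d_def)
qed

end

section \<open>The augmented Lagrangian\<close>

text \<open>\<open>nontriv\<close> makes the smoothness constant M_\<rho> positive, by which the
  inner method divides.\<close>

locale constrained_problem =
  fixes f :: "real^'n \<Rightarrow> real" and h :: "real^'n \<Rightarrow> ereal"
    and A :: "real^'n^'m" and b :: "real^'m" and Lf D :: real
  assumes f: "smooth_convex Lf f" and h: "proper_closed_convex h"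
    and bd: "bounded (edom h)" and D1: "1 \<le> D"
    and diam: "\<And>u v. u \<in> edom h \<Longrightarrow> v \<in> edom h \<Longrightarrow> norm (u - v) \<le> D"
    and nontriv: "0 < Lf \<or> A \<noteq> 0"
begin

lemma Lf_nonneg: "0 \<le> Lf"
  using f by (auto simp: smooth_convex_def dest: lipschitz_on_nonneg)

lemma norm_A_le: "norm (A *v v) \<le> onorm ((*v) A) * norm v"
  by (rule onorm) (rule matrix_vector_mul_bounded_linear)

lemma onorm_A_nonneg: "0 \<le> onorm ((*v) A)"
  by (rule onorm_pos_le) (rule matrix_vector_mul_bounded_linear)

text \<open>The transpose has norm at most that of \<open>A\<close>: the squared norm of v A is the
  pairing of v with A (v A), and one factor is cancelled.\<close>

lemma norm_vector_matrix_le: "norm (v v* A) \<le> onorm ((*v) A) * norm v"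
proof -
  have "norm (v v* A) * norm (v v* A) = v \<bullet> (A *v (v v* A))"
    by (simp only: dot_lmul_matrix[symmetric] power2_norm_eq_inner[symmetric] power2_eq_square)
  also have "\<dots> \<le> norm v * norm (A *v (v v* A))" by (rule norm_cauchy_schwarz)
  also have "\<dots> \<le> norm v * (onorm ((*v) A) * norm (v v* A))"
    by (intro mult_left_mono norm_A_le) simp
  finally have "norm (v v* A) * norm (v v* A) \<le> (onorm ((*v) A) * norm v) * norm (v v* A)"
    by (simp add: ac_simps)
  then show ?thesis
    using onorm_A_nonneg by (cases "norm (v v* A) = 0") (auto simp: mult_le_cancel_right)
qed

lemma aug_M_pos:
  assumes "0 < \<rho>"
  shows "0 < aug_M Lf A \<rho>"
proof -
  have "0 < \<rho> * (onorm ((*v) A))\<^sup>2" if "A \<noteq> 0"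
  proof -
    have "onorm ((*v) A) \<noteq> 0"
    proof
      assume "onorm ((*v) A) = 0"
      then have "A *v v = 0" for v using norm_A_le[of v] by simp
      then show False using that matrix_eq[of A 0] by simp
    qed
    then show ?thesis using assms by simp
  qed
  moreover have "0 \<le> \<rho> * (onorm ((*v) A))\<^sup>2" using assms by simp
  ultimately show ?thesis
    using nontriv Lf_nonneg unfolding aug_M_def by fastforce
qed

text \<open>The terms added to \<open>f\<close> are quadratic, so they expand exactly and only
  \<open>f\<close> contributes a remainder. \<open>c\<close> will be 0 for the smooth part itself
  and e/(8 D^2) for its regularisation.\<close>

lemma aug_smooth_expansion:
  fixes l :: "real^'m" and x :: "real^'n" and c \<rho> :: real
  defines "F \<equiv> \<lambda>u. aug_smooth f A b \<rho> l u + c * (norm (u - x))\<^sup>2"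
  shows "gradient F p = gradient f p + (l + \<rho> *\<^sub>R (A *v p - b)) v* A + (2 * c) *\<^sub>R (p - x)"
    and "F u = F p + gradient F p \<bullet> (u - p) + (f u - f p - gradient f p \<bullet> (u - p))
      + \<rho> / 2 * (norm (A *v (u - p)))\<^sup>2 + c * (norm (u - p))\<^sup>2"
proof -
  let ?d = "gradient f p + (l + \<rho> *\<^sub>R (A *v p - b)) v* A + (2 * c) *\<^sub>R (p - x)"
  have df: "(f has_derivative (\<lambda>v. v \<bullet> gradient f p)) (at p)"
    using smooth_convex_GDERIV[OF f] by (simp add: gderiv_def)
  have dA: "((\<lambda>x. A *v x) has_derivative (\<lambda>v. A *v v)) (at p)"
    by (rule bounded_linear.has_derivative[OF matrix_vector_mul_bounded_linear has_derivative_ident])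
  have v: "v \<bullet> ?d = v \<bullet> gradient f p + l \<bullet> (A *v v)
      + \<rho> * ((A *v p - b) \<bullet> (A *v v)) + 2 * c * (v \<bullet> (p - x))" for v
  proof -
    have "v \<bullet> ((l + \<rho> *\<^sub>R (A *v p - b)) v* A) = (l + \<rho> *\<^sub>R (A *v p - b)) \<bullet> (A *v v)"
      by (subst inner_commute) (rule dot_lmul_matrix)
    then show ?thesis by (simp only: inner_add_right inner_add_left inner_scaleR_left inner_scaleR_right)
  qed
  have "(F has_derivative (\<lambda>v. v \<bullet> ?d)) (at p)"
    unfolding F_def aug_smooth_def power2_norm_eq_inner v
    by (rule derivative_eq_intros df dA refl)+
      (simp add: fun_eq_iff inner_commute algebra_simps)
  then show g: "gradient F p = ?d" by (intro gradient_eqI) (simp add: gderiv_def)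
  have "A *v (u - p) = (A *v u - b) - (A *v p - b)" by (simp add: matrix_vector_mult_diff_distrib)
  then have "(norm (A *v u - b))\<^sup>2 = (norm (A *v p - b))\<^sup>2 + 2 * ((A *v p - b) \<bullet> (A *v (u - p)))
      + (norm (A *v (u - p)))\<^sup>2" "l \<bullet> (A *v u - b) = l \<bullet> (A *v p - b) + l \<bullet> (A *v (u - p))"
    by (simp_all only: power2_norm_eq_inner) (simp_all add: inner_commute algebra_simps)
  moreover have "(norm (u - x))\<^sup>2 = (norm (p - x))\<^sup>2 + 2 * ((u - p) \<bullet> (p - x)) + (norm (u - p))\<^sup>2"
    by (simp add: power2_norm_eq_inner inner_commute algebra_simps)
  ultimately show "F u = F p + gradient F p \<bullet> (u - p) + (f u - f p - gradient f p \<bullet> (u - p))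
      + \<rho> / 2 * (norm (A *v (u - p)))\<^sup>2 + c * (norm (u - p))\<^sup>2"
    unfolding g inner_commute[of ?d] v unfolding F_def aug_smooth_def
    by (simp add: inner_commute[of "gradient f p"] field_simps)
qed

lemmas gradient_aug_smooth = aug_smooth_expansion(1)[where c = 0, simplified]

lemma gradient_aug_smooth_lipschitz:
  assumes "0 \<le> \<rho>"
  shows "norm (gradient (aug_smooth f A b \<rho> l) u - gradient (aug_smooth f A b \<rho> l) w)
    \<le> aug_M Lf A \<rho> * norm (u - w)"
proof -
  have "gradient (aug_smooth f A b \<rho> l) u - gradient (aug_smooth f A b \<rho> l) w
      = (gradient f u - gradient f w) + (\<rho> *\<^sub>R (A *v (u - w))) v* A"
  proof -
    have "l + \<rho> *\<^sub>R (A *v u - b) = (l + \<rho> *\<^sub>R (A *v w - b)) + \<rho> *\<^sub>R (A *v (u - w))"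
      by (simp add: matrix_vector_mult_diff_distrib algebra_simps)
    then show ?thesis by (simp only: gradient_aug_smooth vector_matrix_left_distrib) simp
  qed
  also have "norm \<dots> \<le> norm (gradient f u - gradient f w) + norm ((\<rho> *\<^sub>R (A *v (u - w))) v* A)"
    by (rule norm_triangle_ineq)
  also have "norm (gradient f u - gradient f w) \<le> Lf * norm (u - w)"
    using f lipschitz_onD[of Lf UNIV "gradient f" u w] by (simp add: smooth_convex_def dist_norm)
  also have "norm ((\<rho> *\<^sub>R (A *v (u - w))) v* A) \<le> onorm ((*v) A) * norm (\<rho> *\<^sub>R (A *v (u - w)))"
    by (rule norm_vector_matrix_le)
  also have "\<dots> \<le> onorm ((*v) A) * (\<rho> * (onorm ((*v) A) * norm (u - w)))"
    using assms by (auto intro!: mult_left_mono norm_A_le onorm_A_nonneg)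
  finally show ?thesis by (simp add: aug_M_def power2_eq_square algebra_simps)
qed

text \<open>The proximal term supplies the strong convexity, as e/(8 D^2) = \<mu>/2;
  \<open>f\<close> and the penalty contribute M_\<rho> to the upper bound.\<close>

lemma composite_aug:
  assumes \<rho>: "0 < \<rho>" and e: "0 < e"
  shows "composite (\<lambda>u. aug_smooth f A b \<rho> l u + e / (8 * D\<^sup>2) * (norm (u - x))\<^sup>2) h
    (aug_M Lf A \<rho>) (ialm_mu D e)" (is "composite ?F _ _ _")
proof
  show "0 < ialm_mu D e" using e D1 by (simp add: ialm_mu_def)
  have c: "e / (8 * D\<^sup>2) = ialm_mu D e / 2" by (simp add: ialm_mu_def)
  show "?F p + gradient ?F p \<bullet> (u - p) + ialm_mu D e / 2 * (norm (u - p))\<^sup>2 \<le> ?F u" for p u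
  proof -
    have "0 \<le> \<rho> / 2 * (norm (A *v (u - p)))\<^sup>2" using \<rho> by simp
    then show ?thesis
      using aug_smooth_expansion(2)[of \<rho> l u "e / (8 * D\<^sup>2)" x p] smooth_convex_lower[OF f, of p u]
      unfolding c by linarith
  qed
  show "?F u \<le> ?F p + gradient ?F p \<bullet> (u - p)
      + (aug_M Lf A \<rho> + ialm_mu D e) / 2 * (norm (u - p))\<^sup>2" for u p
  proof -
    have "(norm (A *v (u - p)))\<^sup>2 \<le> (onorm ((*v) A) * norm (u - p))\<^sup>2"
      by (intro power_mono norm_A_le) simp
    then have "\<rho> / 2 * (norm (A *v (u - p)))\<^sup>2 \<le> \<rho> / 2 * ((onorm ((*v) A))\<^sup>2 * (norm (u - p))\<^sup>2)"
      using \<rho> by (intro mult_left_mono) (auto simp: power_mult_distrib)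
    moreover have "(aug_M Lf A \<rho> + ialm_mu D e) / 2 * (norm (u - p))\<^sup>2
        = Lf / 2 * (norm (u - p))\<^sup>2 + \<rho> / 2 * ((onorm ((*v) A))\<^sup>2 * (norm (u - p))\<^sup>2)
          + ialm_mu D e / 2 * (norm (u - p))\<^sup>2"
      by (simp add: aug_M_def distrib_right add_divide_distrib)
    ultimately show ?thesis
      using aug_smooth_expansion(2)[of \<rho> l u "e / (8 * D\<^sup>2)" x p] smooth_convex_upper[OF f, of u p]
      unfolding c by linarith
  qed
qed (rule h bd aug_M_pos[OF \<rho>])+

text \<open>The gradients of the regularised function and of the smooth part differ at
  \<open>y\<close> by \<mu> (y - x), so nonexpansiveness transfers the residual bound to the
  gradient mapping in the test. The allowance e/(2 D) = 2 \<mu> D is split evenly between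
  regularisation and residual.\<close>

lemma inner_test:
  fixes l :: "real^'m" and x :: "real^'n" and e \<rho> :: real and tie :: "nat \<Rightarrow> bool" and j :: nat
  assumes \<rho>: "0 < \<rho>" and e: "0 < e" and x: "x \<in> edom h"
  defines "L \<equiv> aug_M Lf A \<rho>" and "\<mu> \<equiv> ialm_mu D e"
  assumes j: "8 * (L + \<mu>)\<^sup>2 \<le> \<mu>\<^sup>2 * (1 + sqrt (\<mu> / (2 * L)) / 2) ^ (2 * j)"
  shows "ialm_inner_test f Lf h D A b \<rho> tie e x l j"
proof -
  define F where "F = (\<lambda>u. aug_smooth f A b \<rho> l u + e / (8 * D\<^sup>2) * (norm (u - x))\<^sup>2)"
  interpret composite F h L \<mu> unfolding F_def L_def \<mu>_def using \<rho> e by (rule composite_aug)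
  define st where "st = acg tie F h L \<mu> x j"
  define y q d where "y = acg_pt L st" and "q = acg_qt F h L \<mu> st" and "d = norm (y - q)"
  define \<eta> z where "\<eta> = ialm_eta Lf A \<rho> D e" and "z = prox \<eta> h (y - \<eta> *\<^sub>R gradient (aug_smooth f A b \<rho> l) y)"
  have y: "ialm_inner_pt f Lf h D A b \<rho> tie e x l j = y"
    by (simp add: ialm_inner_pt_def Let_def y_def st_def F_def L_def \<mu>_def)
  have \<eta>: "\<eta> = 1 / (2 * L + \<mu>)" by (simp add: \<eta>_def ialm_eta_def L_def \<mu>_def)
  have \<eta>pos: "0 < \<eta>" "1 / \<eta> = 2 * L + \<mu>" using L \<mu> by (simp_all add: \<eta>)
  have "continuous_on UNIV F"
    unfolding F_def aug_smooth_def
    by (intro continuous_intros smooth_convex_continuous[OF f]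
        linear_continuous_on[OF matrix_vector_mul_bounded_linear])
  from acg_residual[OF x this diam, of tie j]
  have "d\<^sup>2 * (1 + sqrt (\<mu> / (2 * L)) / 2) ^ (2 * j) \<le> 2 * D\<^sup>2"
    unfolding d_def y_def q_def st_def .
  then have r: "\<mu>\<^sup>2 * (d\<^sup>2 * (1 + sqrt (\<mu> / (2 * L)) / 2) ^ (2 * j)) \<le> \<mu>\<^sup>2 * (2 * D\<^sup>2)"
    by (rule mult_left_mono) simp
  \<comment> \<open>The 8 in the hypothesis is this 2 * 2^2, the outer 2 matching the bound 2 D^2 on
    the residual.\<close>
  have "2 * (2 * (L + \<mu>) * d)\<^sup>2 = d\<^sup>2 * (8 * (L + \<mu>)\<^sup>2)"
    by (simp only: power_mult_distrib) simp
  also have "\<dots> \<le> d\<^sup>2 * (\<mu>\<^sup>2 * (1 + sqrt (\<mu> / (2 * L)) / 2) ^ (2 * j))"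
    using j by (rule mult_left_mono) simp
  also have "\<dots> = \<mu>\<^sup>2 * (d\<^sup>2 * (1 + sqrt (\<mu> / (2 * L)) / 2) ^ (2 * j))"
    by (rule mult.left_commute)
  also note r
  also have "\<mu>\<^sup>2 * (2 * D\<^sup>2) = 2 * (\<mu> * D)\<^sup>2" by (simp add: power2_eq_square)
  finally have "(2 * (L + \<mu>) * d)\<^sup>2 \<le> (\<mu> * D)\<^sup>2" by simp
  then have d: "2 * (L + \<mu>) * d \<le> \<mu> * D"
    by (rule power2_le_imp_le) (use \<mu> D1 in simp)
  have grad: "gradient F y = gradient (aug_smooth f A b \<rho> l) y + \<mu> *\<^sub>R (y - x)"
    unfolding F_def aug_smooth_expansion(1) gradient_aug_smooth by (simp add: \<mu>_def ialm_mu_def)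
  have "prox_point h (2 * L + \<mu>) (y - \<eta> *\<^sub>R gradient F y) q"
    using acg_qt_prox_point[of st] unfolding y_def q_def \<eta> .
  moreover have "prox_point h (2 * L + \<mu>) (y - \<eta> *\<^sub>R gradient (aug_smooth f A b \<rho> l) y) z"
    unfolding z_def \<eta>pos(2)[symmetric] by (rule prox_point_prox[OF h bd \<eta>pos(1)])
  ultimately have "norm (q - z)
      \<le> norm ((y - \<eta> *\<^sub>R gradient F y) - (y - \<eta> *\<^sub>R gradient (aug_smooth f A b \<rho> l) y))"
    by (rule prox_point_nonexpansive) (use L \<mu> in simp)
  also have "\<dots> = \<eta> * \<mu> * norm (y - x)"
    using \<eta>pos(1) \<mu> by (simp add: grad scaleR_add_right)
  finally have "norm (y - z) \<le> d + \<eta> * \<mu> * norm (y - x)"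
    using norm_triangle_ineq[of "y - q" "q - z"] by (simp add: d_def)
  then have "1 / \<eta> * norm (y - z) \<le> 1 / \<eta> * (d + \<eta> * \<mu> * norm (y - x))"
    using \<eta>pos(1) by (intro mult_left_mono) auto
  also have "\<dots> = (2 * L + \<mu>) * d + \<mu> * norm (y - x)"
    unfolding distrib_left \<eta>pos(2)[symmetric] using \<eta>pos(1) by simp
  \<comment> \<open>\<open>y\<close> is an extrapolated point, so the diameter is applied to
    \<open>q\<close>, which lies in the domain.\<close>
  also have "norm (y - x) \<le> d + D"
  proof -
    have "q \<in> edom h" using acg_qt_prox_point[of st] unfolding q_def prox_point_def by (rule conjunct1)
    then show ?thesis
      using norm_triangle_ineq[of "y - q" "q - x"] diam[OF _ x, of q] unfolding d_def by simp
  qed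
  also have "(2 * L + \<mu>) * d + \<mu> * (d + D) = 2 * (L + \<mu>) * d + \<mu> * D" by (simp add: algebra_simps)
  finally have "1 / \<eta> * norm (y - z) \<le> 2 * (\<mu> * D)" using d \<mu> by simp
  moreover have "2 * (\<mu> * D) = e / (2 * D)" using D1 by (simp add: \<mu>_def ialm_mu_def power2_eq_square)
  moreover have "ialm_G f Lf h D A b \<rho> e l y = (1 / \<eta>) *\<^sub>R (y - z)"
    by (simp add: ialm_G_def grad_map_def \<eta>_def z_def)
  ultimately show ?thesis using \<eta>pos(1) by (simp add: ialm_inner_test_def y)
qed

text \<open>\<open>G\<close> minus the gradient of the smooth part at \<open>y\<close> is a
  subgradient of \<open>h\<close> at \<open>x'\<close>, and the gradient of the smooth part at
  \<open>x'\<close> is that of the Lagrangian at the updated multiplier \<open>l'\<close>. The total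
  first-order error is at most e/D in norm, which the diameter turns into e.\<close>

lemma outer_step:
  fixes l :: "real^'m" and y :: "real^'n" and e \<rho> :: real
  assumes \<rho>: "0 < \<rho>" and e: "0 < e"
  defines "G \<equiv> ialm_G f Lf h D A b \<rho> e l y"
  defines "x' \<equiv> y - ialm_eta Lf A \<rho> D e *\<^sub>R G"
  defines "l' \<equiv> l + \<rho> *\<^sub>R (A *v x' - b)"
  assumes G: "norm G \<le> e / (2 * D)"
  shows "x' \<in> edom h"
    and "w \<in> edom h \<Longrightarrow>
      f x' + fin h x' + l' \<bullet> (A *v x' - b) - e \<le> f w + fin h w + l' \<bullet> (A *v w - b)"
proof -
  define \<eta> L where "\<eta> = ialm_eta Lf A \<rho> D e" and "L = aug_M Lf A \<rho>"
  define \<Psi> where "\<Psi> = gradient (aug_smooth f A b \<rho> l)"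
  have L: "0 < L" unfolding L_def using \<rho> by (rule aug_M_pos)
  have \<mu>: "0 < ialm_mu D e" using e D1 by (simp add: ialm_mu_def)
  have \<eta>: "0 < \<eta>" using L \<mu> by (simp add: \<eta>_def ialm_eta_def L_def)
  \<comment> \<open>Moving the gradient from \<open>y\<close> to \<open>x'\<close> therefore costs
    half the norm of \<open>G\<close>; together with \<open>G\<close> itself this is 3/2, rounded up
    to 2 below.\<close>
  have L\<eta>: "L * \<eta> \<le> 1 / 2" using L \<mu> by (simp add: \<eta>_def ialm_eta_def L_def[symmetric] field_simps)
  have x'_prox: "x' = prox \<eta> h (y - \<eta> *\<^sub>R \<Psi> y)"
    using \<eta> by (simp add: x'_def G_def ialm_G_def grad_map_def \<eta>_def \<Psi>_def)
  have prox: "prox_point h (1 / \<eta>) (y - \<eta> *\<^sub>R \<Psi> y) x'"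
    unfolding x'_prox using h bd \<eta> by (rule prox_point_prox)
  then show x': "x' \<in> edom h" by (simp add: prox_point_def)
  assume w: "w \<in> edom h"
  have yx': "y - x' = \<eta> *\<^sub>R G" by (simp add: x'_def \<eta>_def)
  have "(y - \<eta> *\<^sub>R \<Psi> y - x') = \<eta> *\<^sub>R (G - \<Psi> y)"
    using yx' by (simp add: algebra_simps)
  then have 1: "fin h x' + (G - \<Psi> y) \<bullet> (w - x') \<le> fin h w"
    using prox w \<eta> by (auto simp: prox_point_def)
  have 2: "f x' + gradient f x' \<bullet> (w - x') \<le> f w" using f by (rule smooth_convex_lower)
  have "(l' v* A) \<bullet> (w - x') = l' \<bullet> (A *v w - b) - l' \<bullet> (A *v x' - b)"
    by (simp add: dot_lmul_matrix matrix_vector_mult_diff_distrib inner_diff_right)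
  then have 3: "\<Psi> x' \<bullet> (w - x') = gradient f x' \<bullet> (w - x') + l' \<bullet> (A *v w - b) - l' \<bullet> (A *v x' - b)"
    unfolding \<Psi>_def gradient_aug_smooth l'_def by (simp add: inner_add_left)
  have "norm (\<Psi> y - \<Psi> x') \<le> L * norm (y - x')"
    unfolding \<Psi>_def L_def using \<rho> by (intro gradient_aug_smooth_lipschitz) simp
  also have "\<dots> = L * \<eta> * norm G" using \<eta> by (simp add: yx')
  also have "\<dots> \<le> 1 / 2 * norm G" by (intro mult_right_mono L\<eta>) simp
  finally have "norm (\<Psi> y - \<Psi> x' - G) \<le> 2 * norm G"
    using norm_triangle_ineq4[of "\<Psi> y - \<Psi> x'" G] norm_ge_zero[of G] by linarith
  also have "\<dots> \<le> e / D" using G by simp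
  finally have "norm (\<Psi> y - \<Psi> x' - G) * norm (w - x') \<le> e / D * D"
    using diam[OF w x'] e D1 by (intro mult_mono) auto
  then have "(\<Psi> y - \<Psi> x' - G) \<bullet> (w - x') \<le> e"
    using norm_cauchy_schwarz[of "\<Psi> y - \<Psi> x' - G" "w - x'"] D1 by simp
  then show "f x' + fin h x' + l' \<bullet> (A *v x' - b) - e \<le> f w + fin h w + l' \<bullet> (A *v w - b)"
    using 1 2 3 unfolding inner_diff_left by linarith
qed

end

section \<open>Lagrange multipliers\<close>

context constrained_problem
begin

lemma objective_fin: "x \<in> edom h \<Longrightarrow> objective f h x = ereal (f x + fin h x)"
  unfolding objective_def by (subst ereal_fin[OF h]) simp_all

lemma objective_notin: "x \<notin> edom h \<Longrightarrow> objective f h x = \<infinity>"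
  by (simp add: objective_def edom_def)

lemma opt_attained:
  assumes "x0 \<in> edom h" "A *v x0 = b"
  obtains x where "x \<in> edom h" "A *v x = b" "opt_val f h A b = ereal (f x + fin h x)"
    and "\<And>w. w \<in> edom h \<Longrightarrow> A *v w = b \<Longrightarrow> f x + fin h x \<le> f w + fin h w"
proof -
  have "closed {x. A *v x = b}"
    by (intro closed_Collect_eq continuous_intros)
  moreover have "{x. A *v x = b} \<inter> edom h \<noteq> {}" using assms by auto
  ultimately obtain x where x: "x \<in> {x. A *v x = b} \<inter> edom h"
    and min: "\<And>w. w \<in> {x. A *v x = b} \<inter> edom h \<Longrightarrow> fin h x + f x \<le> fin h w + f w"
    by (rule minimiser_exists[OF h bd smooth_convex_continuous[OF f]]) (rule that)
  have "opt_val f h A b = ereal (f x + fin h x)"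
    unfolding opt_val_def
  proof (rule INF_eqI)
    fix w assume "w \<in> {x. A *v x = b}"
    then show "ereal (f x + fin h x) \<le> objective f h w"
      using min[of w] by (cases "w \<in> edom h") (auto simp: objective_fin objective_notin)
  next
    fix y assume "\<And>i. i \<in> {x. A *v x = b} \<Longrightarrow> y \<le> objective f h i"
    from this[of x] show "y \<le> ereal (f x + fin h x)" using x by (simp add: objective_fin)
  qed
  then show thesis using that[of x] x min by (simp add: add.commute)
qed

text \<open>Separation: the convex set \<open>C\<close> of pairs (constraint value, bound on the
  objective) has (0, v) on its relative boundary, v being the optimal value. A supporting functional
  (p, \<beta>) there has \<beta> > 0 by the relative interior condition, and p/\<beta> is a
  multiplier.\<close>

lemma multiplier_exists:
  assumes xb: "xb \<in> rel_interior (edom h)" "A *v xb = b"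
    and xs: "xs \<in> edom h" "A *v xs = b"
    and min: "\<And>w. w \<in> edom h \<Longrightarrow> A *v w = b \<Longrightarrow> f xs + fin h xs \<le> f w + fin h w"
  shows "\<exists>l. \<forall>w\<in>edom h. f xs + fin h xs \<le> f w + fin h w + l \<bullet> (A *v w - b)"
proof -
  define v where "v = f xs + fin h xs"
  define C where "C = {(u, t). \<exists>x\<in>edom h. u = A *v x - b \<and> f x + fin h x \<le> t}"
  have C_I: "(A *v x - b, t) \<in> C" if "x \<in> edom h" "f x + fin h x \<le> t" for x t
    using that by (auto simp: C_def)
  have cf: "convex_on UNIV f" using f by (simp add: smooth_convex_def)
  have "convex C"
    unfolding convex_alt
  proof (intro ballI allI impI)
    fix y z :: "(real^'m) \<times> real" and r :: real
    assume "y \<in> C" "z \<in> C" and r: "0 \<le> r \<and> r \<le> 1"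
    then obtain x w where x: "x \<in> edom h" "fst y = A *v x - b" "f x + fin h x \<le> snd y"
      and w: "w \<in> edom h" "fst z = A *v w - b" "f w + fin h w \<le> snd z"
      by (auto simp: C_def)
    let ?c = "(1 - r) *\<^sub>R x + r *\<^sub>R w"
    have c: "?c \<in> edom h" "fin h ?c \<le> (1 - r) * fin h x + r * fin h w"
      using convex_fin[OF h x(1) w(1)] r by auto
    have "f ?c \<le> (1 - r) * f x + r * f w" using convex_onD[OF cf] r by auto
    then have "f ?c + fin h ?c \<le> (1 - r) * (f x + fin h x) + r * (f w + fin h w)"
      using c(2) by (simp add: algebra_simps)
    also have "\<dots> \<le> (1 - r) * snd y + r * snd z"
      using x w r by (intro add_mono mult_left_mono) auto
    finally have "(A *v ?c - b, (1 - r) * snd y + r * snd z) \<in> C" by (rule C_I[OF c(1)])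
    moreover have "A *v ?c - b = (1 - r) *\<^sub>R fst y + r *\<^sub>R fst z"
      by (simp add: x w matrix_vector_right_distrib matrix_vector_mult_scaleR algebra_simps)
    ultimately show "(1 - r) *\<^sub>R y + r *\<^sub>R z \<in> C" by (cases y, cases z) simp
  qed
  have P: "(0, t) \<in> C" if "v \<le> t" for t using C_I[OF xs(1), of t] xs that by (simp add: v_def)
  \<comment> \<open>Otherwise the segment from (0, v + 1) could be prolonged beyond (0, v) inside
    \<open>C\<close>, giving a feasible point of value below v.\<close>
  have "(0, v) \<notin> rel_interior C"
  proof
    assume "(0, v) \<in> rel_interior C"
    moreover have "(0, v + 1) \<in> affine hull C" using P by (intro hull_inc) simp
    ultimately obtain e where e: "e > 1" "(1 - e) *\<^sub>R (0, v + 1) + e *\<^sub>R (0, v) \<in> C"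
      using convex_rel_interior_if2[OF \<open>convex C\<close>] by blast
    then obtain x where "x \<in> edom h" "A *v x = b" "f x + fin h x \<le> (1 - e) * (v + 1) + e * v"
      by (auto simp: C_def)
    then show False using min[of x] e(1) by (simp add: v_def algebra_simps)
  qed
  then obtain a where a: "\<And>y. y \<in> C \<Longrightarrow> a \<bullet> (0, v) \<le> a \<bullet> y"
      "\<And>y. y \<in> rel_interior C \<Longrightarrow> a \<bullet> (0, v) < a \<bullet> y"
    using supporting_hyperplane_rel_boundary[OF \<open>convex C\<close> P[OF order_refl]] by metis
  obtain p \<beta> where p: "a = (p, \<beta>)" by (cases a)
  have le: "\<beta> * v \<le> p \<bullet> (A *v x - b) + \<beta> * (f x + fin h x)" if "x \<in> edom h" for x
    using a(1)[OF C_I[OF that order_refl]] by (simp add: p)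
  have "0 \<le> \<beta>" using a(1)[OF P[of "v + 1"]] by (simp add: p algebra_simps)
  \<comment> \<open>If \<beta> = 0, p is nonnegative on every A x - b; prolonging the segment from x
    beyond \<open>xb\<close> reverses the sign. So the functional vanishes on \<open>C\<close>,
    against strictness on the relative interior.\<close>
  moreover have "\<beta> \<noteq> 0"
  proof
    assume \<beta>: "\<beta> = 0"
    have z: "p \<bullet> (A *v x - b) = 0" if x: "x \<in> edom h" for x
    proof -
      have "x \<in> affine hull edom h" using x by (rule hull_inc)
      then obtain e where e: "e > 1" "(1 - e) *\<^sub>R x + e *\<^sub>R xb \<in> edom h"
        using convex_rel_interior_if2[OF convex_edom[OF h] xb(1)] by blast
      have "A *v ((1 - e) *\<^sub>R x + e *\<^sub>R xb) - b = (1 - e) *\<^sub>R (A *v x - b)"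
        by (simp add: xb(2) matrix_vector_right_distrib matrix_vector_mult_scaleR algebra_simps)
      then have "0 \<le> (1 - e) * (p \<bullet> (A *v x - b))"
        using le[OF e(2)] by (simp add: \<beta>)
      then have "p \<bullet> (A *v x - b) \<le> 0" using e(1) by (simp add: zero_le_mult_iff)
      then show ?thesis using le[OF x] by (simp add: \<beta>)
    qed
    have "C \<noteq> {}" using P by blast
    then obtain y where y: "y \<in> rel_interior C"
      using rel_interior_eq_empty[OF \<open>convex C\<close>] by blast
    then have "y \<in> C" using rel_interior_subset by blast
    then have "a \<bullet> y = 0" using z by (auto simp: C_def p \<beta>)
    then show False using a(2)[OF y] by (simp add: p \<beta>)
  qed
  ultimately have \<beta>: "0 < \<beta>" by simp
  show ?thesis
  proof (intro exI ballI)
    fix w assume "w \<in> edom h"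
    from le[OF this] show "f xs + fin h xs \<le> f w + fin h w + ((1 / \<beta>) *\<^sub>R p) \<bullet> (A *v w - b)"
      using \<beta> by (simp add: v_def field_simps)
  qed
qed

text \<open>Weak duality bounds the dual function by the value at \<open>xs\<close>, and
  \<open>l0\<close> attains this bound, so maximising means reaching it.\<close>

lemma dual_opt_eq:
  assumes xs: "xs \<in> edom h" "A *v xs = b"
    and l0: "\<And>w. w \<in> edom h \<Longrightarrow> f xs + fin h xs \<le> f w + fin h w + l0 \<bullet> (A *v w - b)"
  shows "dual_opt f h A b = {l. \<forall>w\<in>edom h. f xs + fin h xs \<le> f w + fin h w + l \<bullet> (A *v w - b)}"
proof -
  have lag: "lagrangian f h A b w l = ereal (f w + fin h w + l \<bullet> (A *v w - b))" if "w \<in> edom h" for w l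
    using that by (simp add: lagrangian_def objective_fin)
  have lag': "lagrangian f h A b w l = \<infinity>" if "w \<notin> edom h" for w l
    using that by (simp add: lagrangian_def objective_notin)
  have le: "dual_fun f h A b l \<le> ereal (f xs + fin h xs)" for l
    unfolding dual_fun_def by (rule INF_lower2[of xs]) (use lag[OF xs(1)] xs(2) in auto)
  have ge: "ereal (f xs + fin h xs) \<le> dual_fun f h A b l \<longleftrightarrow>
      (\<forall>w\<in>edom h. f xs + fin h xs \<le> f w + fin h w + l \<bullet> (A *v w - b))" for l
  proof -
    have "ereal (f xs + fin h xs) \<le> lagrangian f h A b w l \<longleftrightarrow>
        (w \<in> edom h \<longrightarrow> f xs + fin h xs \<le> f w + fin h w + l \<bullet> (A *v w - b))" for w
      by (cases "w \<in> edom h") (simp_all add: lag lag')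
    then show ?thesis unfolding dual_fun_def le_INF_iff by auto
  qed
  have "ereal (f xs + fin h xs) \<le> dual_fun f h A b l0" using l0 by (simp add: ge)
  then have "is_arg_max (dual_fun f h A b) (\<lambda>_. True) l \<longleftrightarrow> ereal (f xs + fin h xs) \<le> dual_fun f h A b l" for l
    using le unfolding is_arg_max_linorder by (meson order_trans)
  then show ?thesis by (simp add: dual_opt_def ge)
qed

text \<open>Makes R the norm of an actual multiplier: the dual optimal set is nonempty and an
  intersection of closed sets, so it has a point nearest to the initial multiplier 0.\<close>

lemma min_norm_multiplier:
  assumes "rel_interior (edom h) \<inter> {x. A *v x = b} \<noteq> {}"
  obtains v l where "opt_val f h A b = ereal v"
    and "norm l = Inf ((\<lambda>l. norm (l - 0)) ` dual_opt f h A b)"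
    and "\<And>w. w \<in> edom h \<Longrightarrow> v \<le> f w + fin h w + l \<bullet> (A *v w - b)"
    and "\<exists>x\<in>edom h. A *v x = b \<and> f x + fin h x = v"
proof -
  obtain xb where xb: "xb \<in> rel_interior (edom h)" "A *v xb = b" using assms by blast
  then have "xb \<in> edom h" using rel_interior_subset by blast
  then obtain xs where xs: "xs \<in> edom h" "A *v xs = b" and opt: "opt_val f h A b = ereal (f xs + fin h xs)"
    and min: "\<And>w. w \<in> edom h \<Longrightarrow> A *v w = b \<Longrightarrow> f xs + fin h xs \<le> f w + fin h w"
    by (rule opt_attained[OF _ xb(2)]) (rule that)
  obtain l0 where l0: "\<And>w. w \<in> edom h \<Longrightarrow> f xs + fin h xs \<le> f w + fin h w + l0 \<bullet> (A *v w - b)"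
    using multiplier_exists[OF xb xs min] by blast
  note eq = dual_opt_eq[OF xs l0]
  have "dual_opt f h A b
      = (\<Inter>w\<in>edom h. {l. f xs + fin h xs \<le> f w + fin h w + l \<bullet> (A *v w - b)})"
    by (auto simp: eq)
  also have "closed \<dots>"
    by (intro closed_INT ballI closed_Collect_le continuous_intros)
  finally have "closed (dual_opt f h A b)" .
  moreover have "l0 \<in> dual_opt f h A b" using l0 by (simp add: eq)
  then have "dual_opt f h A b \<noteq> {}" by blast
  ultimately obtain l where l: "l \<in> dual_opt f h A b"
    "\<And>y. y \<in> dual_opt f h A b \<Longrightarrow> dist 0 l \<le> dist 0 y"
    using distance_attains_inf[of "dual_opt f h A b" 0] by metis
  have "Inf ((\<lambda>l. norm (l - 0)) ` dual_opt f h A b) = norm l"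
    by (rule cInf_eq_minimum) (use l in auto)
  moreover have "f xs + fin h xs \<le> f w + fin h w + l \<bullet> (A *v w - b)" if "w \<in> edom h" for w
    using l(1) that by (simp add: eq)
  ultimately show thesis using that[OF opt, of l] xs by auto
qed

end

section \<open>Complexity\<close>

lemma ln_one_plus_ge:
  assumes "0 < (t::real)"
  shows "t / (1 + t) \<le> ln (1 + t)"
proof -
  have "ln (1 / (1 + t)) \<le> 1 / (1 + t) - 1" using assms by (intro ln_le_minus_one) simp
  then show ?thesis using assms by (simp add: ln_div field_simps)
qed

text \<open>With t the excess of the growth factor over 1, it suffices that (1 + t)^j reaches E = 3
  (1 + L/\<mu>), as 3^2 \<ge> 8. The count ln E / ln (1 + t) becomes a multiple of sqrt (L/\<mu>)
  through ln (1 + t) \<ge> t/(1 + t).\<close>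

lemma inner_count:
  fixes L \<mu> :: real
  assumes L: "0 < L" and \<mu>: "0 < \<mu>"
  obtains j where "8 * (L + \<mu>)\<^sup>2 \<le> \<mu>\<^sup>2 * (1 + sqrt (\<mu> / (2 * L)) / 2) ^ (2 * j)"
    and "real (Suc j) \<le> 2 + (1 + 3 * sqrt (L / \<mu>)) * ln (3 * (1 + L / \<mu>))"
proof -
  define t \<kappa> where "t = sqrt (\<mu> / (2 * L)) / 2" and "\<kappa> = L / \<mu>"
  define E where "E = 3 * (1 + \<kappa>)"
  have t: "0 < t" and \<kappa>: "0 < \<kappa>" using L \<mu> by (simp_all add: t_def \<kappa>_def)
  have E: "1 < E" using \<kappa> by (simp add: E_def)
  have lt: "0 < ln (1 + t)" using t by (intro ln_gt_zero) simp
  \<comment> \<open>The square is 9/8, since t^2 = 1/(8 \<kappa>); the factor 3 of the rate comes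
    from here.\<close>
  have "1 \<le> (3 * sqrt \<kappa> * t)\<^sup>2"
    using L \<mu> by (simp add: t_def \<kappa>_def power_mult_distrib power_divide)
  then have "1\<^sup>2 \<le> (3 * sqrt \<kappa> * t)\<^sup>2" by simp
  then have "1 \<le> 3 * sqrt \<kappa> * t" by (rule power2_le_imp_le) (use \<kappa> t in simp)
  then have "1 + t \<le> (1 + 3 * sqrt \<kappa>) * t" by (simp add: algebra_simps)
  then have "1 / ln (1 + t) \<le> 1 + 3 * sqrt \<kappa>"
  proof -
    assume le: "1 + t \<le> (1 + 3 * sqrt \<kappa>) * t"
    have "1 \<le> (1 + 3 * sqrt \<kappa>) * (t / (1 + t))" using le t by (simp add: field_simps)
    also have "\<dots> \<le> (1 + 3 * sqrt \<kappa>) * ln (1 + t)"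
      using ln_one_plus_ge[OF t] \<kappa> by (intro mult_left_mono) auto
    finally show ?thesis using lt by (simp add: field_simps)
  qed
  then have rate: "ln E / ln (1 + t) \<le> (1 + 3 * sqrt \<kappa>) * ln E"
    using mult_right_mono[of "1 / ln (1 + t)" "1 + 3 * sqrt \<kappa>" "ln E"] E by simp
  \<comment> \<open>The summand 2 of the final count pays for this ceiling and for the
    successor.\<close>
  define j where "j = nat \<lceil>ln E / ln (1 + t)\<rceil>"
  have j: "ln E / ln (1 + t) \<le> real j" "real j \<le> ln E / ln (1 + t) + 1"
    using E lt by (simp_all add: j_def real_nat_ceiling_ge)
  have "ln E \<le> real j * ln (1 + t)" using j(1) lt by (simp add: field_simps)
  also have "\<dots> = ln ((1 + t) ^ j)" using t by (simp add: ln_realpow)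
  finally have "E \<le> (1 + t) ^ j" using E t by simp
  then have "E\<^sup>2 \<le> ((1 + t) ^ j)\<^sup>2" using E by (intro power_mono) auto
  then have E2: "E\<^sup>2 \<le> (1 + t) ^ (2 * j)" by (simp only: power_even_eq)
  have "L + \<mu> = \<mu> * (1 + \<kappa>)" using \<mu> by (simp add: \<kappa>_def field_simps)
  then have "8 * (L + \<mu>)\<^sup>2 = \<mu>\<^sup>2 * (8 * (1 + \<kappa>)\<^sup>2)" by (simp add: power_mult_distrib)
  also have "\<dots> \<le> \<mu>\<^sup>2 * E\<^sup>2" unfolding E_def power_mult_distrib by (intro mult_left_mono) auto
  also have "\<mu>\<^sup>2 * E\<^sup>2 \<le> \<mu>\<^sup>2 * (1 + t) ^ (2 * j)" using E2 by (rule mult_left_mono) simp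
  finally show thesis
  proof (intro that[of j])
    show "real (Suc j) \<le> 2 + (1 + 3 * sqrt (L / \<mu>)) * ln (3 * (1 + L / \<mu>))"
      using j(2) rate by (simp add: E_def \<kappa>_def)
  qed (simp add: t_def)
qed

text \<open>The logarithm of \<kappa> is absorbed into that of 1 + Q at the price of a factor c,
  through ln c \<le> c - 1. The constant is 482 = 48 * 10 + 2.\<close>

lemma inner_cost_le:
  fixes \<kappa> c Q :: real
  assumes \<kappa>: "0 \<le> \<kappa>" "sqrt \<kappa> \<le> 16 * c * Q" and c: "1 \<le> c" and Q: "0 \<le> Q"
  shows "2 + (1 + 3 * sqrt \<kappa>) * ln (3 * (1 + \<kappa>)) \<le> 482 * c\<^sup>2 * ((1 + Q) * (1 + ln (1 + Q)))"
proof -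
  have cQ: "0 \<le> c * Q" using c Q by simp
  have lnQ: "0 \<le> ln (1 + Q)" using Q by simp
  have s: "sqrt \<kappa> \<le> 16 * (c * Q)" using \<kappa>(2) by simp
  have "1 + \<kappa> \<le> (1 + sqrt \<kappa>)\<^sup>2" using \<kappa>(1) by (simp add: power2_eq_square algebra_simps)
  also have "\<dots> \<le> (16 * (c * (1 + Q)))\<^sup>2"
    using s c \<kappa>(1) by (intro power_mono) (auto simp: algebra_simps)
  finally have "ln (3 * (1 + \<kappa>)) \<le> ln (3 * (16 * (c * (1 + Q)))\<^sup>2)"
    using \<kappa>(1) by (subst ln_le_cancel_iff) (auto intro: order_less_le_trans[of 0 "1 + \<kappa>"])
  also have "\<dots> = ln 3 + 2 * (ln 16 + (ln c + ln (1 + Q)))"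
  proof -
    have pos: "0 < c" "0 < 1 + Q" "0 < c * (1 + Q)" using c Q by simp_all
    have "ln (3 * (16 * (c * (1 + Q)))\<^sup>2) = ln 3 + ln ((16 * (c * (1 + Q)))\<^sup>2)"
      by (rule ln_mult_pos) (use pos in simp_all)
    also have "ln ((16 * (c * (1 + Q)))\<^sup>2) = 2 * ln (16 * (c * (1 + Q)))"
      using ln_realpow[of "16 * (c * (1 + Q))" 2] pos by simp
    also have "ln (16 * (c * (1 + Q))) = ln 16 + ln (c * (1 + Q))"
      by (rule ln_mult_pos) (use pos in simp_all)
    also have "ln (c * (1 + Q)) = ln c + ln (1 + Q)" by (rule ln_mult_pos) (use pos in simp_all)
    finally show ?thesis .
  qed
  also have "\<dots> \<le> 2 + 2 * (4 + ((c - 1) + ln (1 + Q)))"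
  proof -
    have "ln (16::real) = 4 * ln 2" using ln_realpow[of 2 4] by simp
    then show ?thesis
      using ln_le_minus_one[of "3::real"] ln_le_minus_one[of "2::real"] ln_le_minus_one[of c] c by simp
  qed
  also have "\<dots> \<le> 10 * c * (1 + ln (1 + Q))"
  proof -
    have eq: "10 * c * (1 + ln (1 + Q)) = 10 * c + 10 * (c * ln (1 + Q))" by (simp add: algebra_simps)
    have "ln (1 + Q) \<le> c * ln (1 + Q)" using mult_right_mono[OF c lnQ] by simp
    then have "2 * ln (1 + Q) \<le> 10 * (c * ln (1 + Q))" using lnQ by linarith
    moreover have "8 + 2 * c \<le> 10 * c" using c by simp
    ultimately show ?thesis unfolding eq by simp
  qed
  finally have ln: "ln (3 * (1 + \<kappa>)) \<le> 10 * c * (1 + ln (1 + Q))" .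
  have "(1 + 3 * sqrt \<kappa>) * ln (3 * (1 + \<kappa>)) \<le> (48 * c * (1 + Q)) * (10 * c * (1 + ln (1 + Q)))"
    using s c \<kappa>(1) Q lnQ by (intro mult_mono ln) (auto simp: algebra_simps)
  also have "\<dots> = 480 * (c\<^sup>2 * ((1 + Q) * (1 + ln (1 + Q))))" by (simp add: power2_eq_square)
  finally have "(1 + 3 * sqrt \<kappa>) * ln (3 * (1 + \<kappa>)) \<le> 480 * (c\<^sup>2 * ((1 + Q) * (1 + ln (1 + Q))))" .
  moreover have "1 * (1 * 1) \<le> c\<^sup>2 * ((1 + Q) * (1 + ln (1 + Q)))"
    using c Q lnQ by (intro mult_mono) auto
  ultimately show ?thesis by simp
qed

section \<open>Outer iterations and the total count\<close>

context constrained_problem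
begin

text \<open>Approximate minimality is tested at \<open>xs\<close>, where the constraint term
  vanishes, and the multiplier inequality at \<open>x'\<close>; together they bound the pairing of
  l' - ls with A x' - b by e. As l' - l is \<rho> times A x' - b, expanding the square of l - ls
  gives the estimate on multipliers.\<close>

lemma outer_iteration:
  fixes l ls :: "real^'m" and x :: "real^'n" and e \<rho> v :: real and tie :: "nat \<Rightarrow> bool"
  defines "\<kappa> \<equiv> aug_M Lf A \<rho> / ialm_mu D e"
  assumes \<rho>: "0 < \<rho>" and e: "0 < e" and x: "x \<in> edom h"
    and xs: "xs \<in> edom h" "A *v xs = b" "f xs + fin h xs = v"
    and ls: "\<And>w. w \<in> edom h \<Longrightarrow> v \<le> f w + fin h w + ls \<bullet> (A *v w - b)"
  obtains y x' l' N where "ialm_outer f Lf h D A b \<rho> tie e x l y x' l' N"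
    and "x' \<in> edom h" and "norm (ialm_G f Lf h D A b \<rho> e l y) \<le> e / (2 * D)"
    and "real N \<le> 2 + (1 + 3 * sqrt \<kappa>) * ln (3 * (1 + \<kappa>))"
    and "f x' + fin h x' + l' \<bullet> (A *v x' - b) - e \<le> v"
    and "(norm (l' - ls))\<^sup>2 + (norm (l' - l))\<^sup>2 \<le> (norm (l - ls))\<^sup>2 + 2 * \<rho> * e"
    and "l' = l + \<rho> *\<^sub>R (A *v x' - b)"
proof -
  let ?test = "ialm_inner_test f Lf h D A b \<rho> tie e x l"
  have \<mu>: "0 < ialm_mu D e" using e D1 by (simp add: ialm_mu_def)
  obtain j0 where j0: "?test j0" "real (Suc j0) \<le> 2 + (1 + 3 * sqrt \<kappa>) * ln (3 * (1 + \<kappa>))"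
    using inner_count[OF aug_M_pos[OF \<rho>] \<mu>] inner_test[OF \<rho> e x] unfolding \<kappa>_def by metis
  \<comment> \<open>The method accepts the first successful point, which comes no later than the
    index \<open>j0\<close> whose cost is bounded.\<close>
  define j where "j = (LEAST j. ?test j)"
  have j: "?test j" unfolding j_def using j0(1) by (rule LeastI)
  have jmin: "\<not> ?test i" if "i < j" for i using that unfolding j_def by (rule not_less_Least)
  have "j \<le> j0" unfolding j_def using j0(1) by (rule Least_le)
  define y where "y = ialm_inner_pt f Lf h D A b \<rho> tie e x l j"
  define x' where "x' = y - ialm_eta Lf A \<rho> D e *\<^sub>R ialm_G f Lf h D A b \<rho> e l y"
  define l' where "l' = l + \<rho> *\<^sub>R (A *v x' - b)"
  have G: "norm (ialm_G f Lf h D A b \<rho> e l y) \<le> e / (2 * D)"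
    using j by (simp add: ialm_inner_test_def y_def)
  have x': "x' \<in> edom h" unfolding x'_def by (rule outer_step(1)[OF \<rho> e G])
  have gap: "f x' + fin h x' + l' \<bullet> (A *v x' - b) - e \<le> v"
    using outer_step(2)[OF \<rho> e G xs(1), folded x'_def, folded l'_def] xs by simp
  have "(l' - ls) \<bullet> (A *v x' - b) \<le> e" using gap ls[OF x'] by (simp add: inner_diff_left)
  then have "\<rho> * ((l' - ls) \<bullet> (A *v x' - b)) \<le> \<rho> * e" using \<rho> by simp
  moreover have "\<rho> * ((l' - ls) \<bullet> (A *v x' - b)) = (l' - ls) \<bullet> (l' - l)" by (simp add: l'_def)
  moreover have "(norm (l - ls))\<^sup>2 = (norm (l' - ls))\<^sup>2 + (norm (l' - l))\<^sup>2 - 2 * ((l' - ls) \<bullet> (l' - l))"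
    by (simp add: power2_norm_eq_inner inner_commute algebra_simps)
  ultimately have "(norm (l' - ls))\<^sup>2 + (norm (l' - l))\<^sup>2 \<le> (norm (l - ls))\<^sup>2 + 2 * \<rho> * e" by simp
  moreover have "ialm_outer f Lf h D A b \<rho> tie e x l y x' l' (Suc j)"
    using j jmin unfolding ialm_outer_def x'_def l'_def y_def by blast
  moreover have "real (Suc j) \<le> 2 + (1 + 3 * sqrt \<kappa>) * ln (3 * (1 + \<kappa>))"
    using j0(2) \<open>j \<le> j0\<close> by simp
  ultimately show thesis using that x' G gap l'_def by blast
qed

text \<open>With \<rho> = 1/\<delta> and \<mu> \<ge> \<delta>/(16 D^2), the condition number is at
  most 16 D^2 times the sum of Lf/\<delta> and the square of the norm of \<open>A\<close> over
  \<delta>. Substituting 1/\<delta> = 4 c (R + D)/\<epsilon> yields the two terms of the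
  complexity.\<close>

lemma sqrt_condition_number_le:
  fixes \<alpha> R \<epsilon> c \<delta> e :: real
  assumes \<alpha>: "0 < \<alpha>" "\<alpha> < 1" and R: "0 \<le> R" and \<epsilon>: "0 < \<epsilon>"
  defines "\<delta> \<equiv> primal_tol \<alpha> R D \<epsilon>" and "c \<equiv> 1 / (1 - \<alpha>)"
  assumes e: "\<delta> / 4 \<le> e"
  shows "sqrt (aug_M Lf A (inverse \<delta>) / ialm_mu D e)
    \<le> 16 * c * (D * (sqrt ((R + D) * Lf) / sqrt \<epsilon> + (R + D) * onorm ((*v) A) / \<epsilon>))"
proof -
  define a where "a = onorm ((*v) A)"
  define s1 s2 where "s1 = sqrt ((R + D) * Lf) / sqrt \<epsilon>" and "s2 = (R + D) * a / \<epsilon>"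
  have c: "1 \<le> c" using \<alpha> by (simp add: c_def)
  have a: "0 \<le> a" unfolding a_def by (rule onorm_A_nonneg)
  have \<delta>: "0 < \<delta>" using \<alpha> R D1 \<epsilon> by (simp add: \<delta>_def primal_tol_def)
  have inv: "inverse \<delta> = 4 * c * ((R + D) / \<epsilon>)"
    by (simp add: \<delta>_def primal_tol_def c_def field_simps)
  have s1: "0 \<le> s1" "s1\<^sup>2 = (R + D) * Lf / \<epsilon>"
    using R D1 \<epsilon> Lf_nonneg by (simp_all add: s1_def power_divide)
  have s2: "0 \<le> s2" using R D1 \<epsilon> a by (simp add: s2_def)
  have M: "0 \<le> aug_M Lf A (inverse \<delta>)" using aug_M_pos[of "inverse \<delta>"] \<delta> by simp
  have "aug_M Lf A (inverse \<delta>) / ialm_mu D e \<le> aug_M Lf A (inverse \<delta>) / ialm_mu D (\<delta> / 4)"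
  proof (rule divide_left_mono[OF _ M])
    show "ialm_mu D (\<delta> / 4) \<le> ialm_mu D e" unfolding ialm_mu_def using e by (rule divide_right_mono) simp
    show "0 < ialm_mu D e * ialm_mu D (\<delta> / 4)" using e \<delta> D1 by (simp add: ialm_mu_def)
  qed
  also have "\<dots> = 16 * D\<^sup>2 * (Lf * inverse \<delta> + (a * inverse \<delta>)\<^sup>2)"
    using \<delta> D1 by (simp add: aug_M_def a_def ialm_mu_def field_simps power2_eq_square)
  also have "Lf * inverse \<delta> + (a * inverse \<delta>)\<^sup>2 = 4 * c * s1\<^sup>2 + 16 * c\<^sup>2 * s2\<^sup>2"
  proof -
    have "Lf * inverse \<delta> = 4 * c * s1\<^sup>2" by (simp add: inv s1(2))
    moreover have "(a * inverse \<delta>)\<^sup>2 = 16 * c\<^sup>2 * s2\<^sup>2"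
      by (simp add: inv s2_def power2_eq_square)
    ultimately show ?thesis by simp
  qed
  \<comment> \<open>4 c is raised to 16 c^2 so that both squares share the factor (16 c
    D)^2.\<close>
  also have "16 * D\<^sup>2 * (4 * c * s1\<^sup>2 + 16 * c\<^sup>2 * s2\<^sup>2)
      \<le> 16 * D\<^sup>2 * (16 * c\<^sup>2 * s1\<^sup>2 + 16 * c\<^sup>2 * s2\<^sup>2)"
    using c by (intro mult_left_mono add_right_mono mult_right_mono) (auto simp: power2_eq_square)
  also have "16 * D\<^sup>2 * (16 * c\<^sup>2 * s1\<^sup>2 + 16 * c\<^sup>2 * s2\<^sup>2) = (16 * c * D)\<^sup>2 * (s1\<^sup>2 + s2\<^sup>2)"
    by (simp add: power2_eq_square algebra_simps)
  also have "\<dots> \<le> (16 * c * D)\<^sup>2 * (s1 + s2)\<^sup>2"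
    using s1 s2 by (intro mult_left_mono) (auto simp: power2_sum)
  also have "(16 * c * D)\<^sup>2 * (s1 + s2)\<^sup>2 = (16 * c * (D * (s1 + s2)))\<^sup>2"
    by (simp only: power_mult_distrib mult.assoc)
  finally have "aug_M Lf A (inverse \<delta>) / ialm_mu D e \<le> (16 * c * (D * (s1 + s2)))\<^sup>2" .
  then have "sqrt (aug_M Lf A (inverse \<delta>) / ialm_mu D e) \<le> \<bar>16 * c * (D * (s1 + s2))\<bar>"
    using real_sqrt_le_mono by fastforce
  also have "\<dots> = 16 * c * (D * (s1 + s2))" using c D1 s1 s2 by simp
  finally show ?thesis by (simp only: s1_def s2_def a_def)
qed

text \<open>Induction on the number of outer iterations, with the alternative that the method has
  already returned a solution. The invariant caps the number of iterations without return, so the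
  alternative must occur.\<close>

lemma ialm_terminates:
  fixes \<alpha> R \<epsilon> v :: real and ls :: "real^'m" and x0 xs :: "real^'n" and tie :: "nat \<Rightarrow> nat \<Rightarrow> bool"
  assumes x0: "x0 \<in> edom h" and \<alpha>: "0 < \<alpha>" "\<alpha> < 1" and \<epsilon>: "0 < \<epsilon>"
    and xs: "xs \<in> edom h" "A *v xs = b" "f xs + fin h xs = v"
    and v: "opt_val f h A b = ereal v"
    and ls: "\<And>w. w \<in> edom h \<Longrightarrow> v \<le> f w + fin h w + ls \<bullet> (A *v w - b)" and R: "R = norm ls"
  defines "\<delta> \<equiv> primal_tol \<alpha> R D \<epsilon>" and "c \<equiv> 1 / (1 - \<alpha>)"
    and "Q \<equiv> D * (sqrt ((R + D) * Lf) / sqrt \<epsilon> + (R + D) * onorm ((*v) A) / \<epsilon>)"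
  defines "B \<equiv> 482 * c\<^sup>2 * ((1 + Q) * (1 + ln (1 + Q)))"
  shows "\<exists>x l N. ialm_returns f Lf h D A b x0 (inverse \<delta>) \<delta> \<alpha> \<delta> (1/2) tie x l N
    \<and> primal_sol f h A b \<epsilon> x \<and> real N \<le> (2 * R\<^sup>2 + 2 * c + 1) * B" (is "?goal")
proof -
  define \<rho> where "\<rho> = inverse \<delta>"
  define e where "e k = ialm_eps \<delta> \<alpha> (1/2) \<rho> \<delta> k" for k
  let ?reach = "ialm_reach f Lf h D A b x0 \<rho> \<delta> \<alpha> \<delta> (1/2) tie"
  have R0: "0 \<le> R" by (simp add: R)
  have c: "1 \<le> c" using \<alpha> by (simp add: c_def)
  have RD: "0 < R + D" using R0 D1 by simp
  have cR: "R \<le> c * R" using mult_right_mono[OF c R0] by simp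
  have cD: "c \<le> c * D" using mult_left_mono[OF D1, of c] c by simp
  have cRD: "4 * c * (R + D) = 4 * (c * R) + 4 * (c * D)" by (simp add: algebra_simps)
  have \<delta>: "0 < \<delta>" using \<alpha> RD \<epsilon> by (simp add: \<delta>_def primal_tol_def)
  \<comment> \<open>This identity explains the tolerance: the objective gap will be a multiple of
    \<delta> of at most 4 c (R + D).\<close>
  have \<delta>\<epsilon>: "\<delta> * (4 * c * (R + D)) = \<epsilon>"
    using \<alpha> RD by (simp add: \<delta>_def primal_tol_def c_def)
  have \<rho>: "0 < \<rho>" "\<rho> * \<delta> = 1" using \<delta> by (simp_all add: \<rho>_def)
  have Q: "0 \<le> Q"
    unfolding Q_def using D1 RD \<epsilon> Lf_nonneg onorm_A_nonneg by simp
  have B: "0 \<le> B" unfolding B_def using c Q by simp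
  have e: "e k = \<delta> * (\<alpha> ^ k + 1 / 2) / 2" for k
    using \<delta> by (simp add: e_def ialm_eps_def \<rho>_def power2_eq_square field_simps)
  have \<alpha>k: "0 < \<alpha> ^ k" "\<alpha> ^ k \<le> 1" for k using \<alpha> by (simp_all add: power_le_one)
  have e_bounds: "\<delta> / 4 \<le> e k" "e k \<le> 3 / 4 * \<delta>" for k
    using \<delta> \<alpha>k[of k] by (simp_all add: e mult_le_cancel_left)
  have e_pos: "0 < e k" for k using e_bounds(1)[of k] \<delta> by linarith
  have \<rho>e: "2 * \<rho> * e k = \<alpha> ^ k + 1 / 2" for k using \<rho> by (simp add: e)
  have geo: "(\<Sum>k<K. \<alpha> ^ k) \<le> c" for K
  proof -
    have "(\<Sum>k<K. \<alpha> ^ k) = (1 - \<alpha> ^ K) / (1 - \<alpha>)" using \<alpha> by (simp add: sum_gp_strict)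
    also have "\<dots> \<le> c" unfolding c_def using \<alpha> \<alpha>k[of K] by (intro divide_right_mono) auto
    finally show ?thesis .
  qed
  \<comment> \<open>An iteration that does not stop moves the multiplier by at least 1 and is
    charged \<alpha>^k + 1/2; the net gain of 1/2 accumulates to K/2, the powers of \<alpha> to at
    most c.\<close>
  define inv where "inv K x l N \<longleftrightarrow> ?reach K x l N \<and> x \<in> edom h \<and> real N \<le> real K * B
    \<and> (norm (l - ls))\<^sup>2 + real K / 2 \<le> R\<^sup>2 + (\<Sum>k<K. \<alpha> ^ k)" for K x l N
  have K_le: "real K \<le> 2 * R\<^sup>2 + 2 * c" "norm (l - ls) \<le> R + c" if "inv K x l N" for K x l N
  proof -
    have *: "(norm (l - ls))\<^sup>2 + real K / 2 \<le> R\<^sup>2 + c" using that geo[of K] by (simp add: inv_def)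
    then show "real K \<le> 2 * R\<^sup>2 + 2 * c" using zero_le_power2[of "norm (l - ls)"] by linarith
    have "c * 1 \<le> c * c" using c by (intro mult_left_mono) auto
    moreover have "0 \<le> R * c" using R0 c by simp
    ultimately have "(norm (l - ls))\<^sup>2 \<le> (R + c)\<^sup>2" using * by (simp add: power2_eq_square algebra_simps)
    then show "norm (l - ls) \<le> R + c" by (rule power2_le_imp_le) (use R0 c in simp)
  qed
  have "?goal \<or> (\<exists>x l N. inv K x l N)" for K
  proof (induction K)
    case 0
    have "1 / \<delta> \<le> D / \<delta>" using D1 \<delta> by (intro divide_right_mono) auto
    then have "2 * (1 / 2) * \<rho> \<le> D / \<delta>" by (simp add: \<rho>_def inverse_eq_divide)
    then have "?reach 0 x0 0 0"
      by (intro ialm_reach.init x0 \<rho>(1) \<delta> \<alpha>) simp_all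
    then have "inv 0 x0 0 0" using x0 by (simp add: inv_def R)
    then show ?case by blast
  next
    case (Suc K)
    show ?case
    proof (cases ?goal)
      case False
      then obtain x l N where inv: "inv K x l N" using Suc by blast
      then have reach: "?reach K x l N" and x: "x \<in> edom h" and N: "real N \<le> real K * B"
        and I: "(norm (l - ls))\<^sup>2 + real K / 2 \<le> R\<^sup>2 + (\<Sum>k<K. \<alpha> ^ k)"
        by (simp_all add: inv_def)
      define \<kappa> where "\<kappa> = aug_M Lf A \<rho> / ialm_mu D (e K)"
      obtain y x' l' N' where out: "ialm_outer f Lf h D A b \<rho> (tie K) (e K) x l y x' l' N'"
        and x': "x' \<in> edom h" and G: "norm (ialm_G f Lf h D A b \<rho> (e K) l y) \<le> e K / (2 * D)"
        and N': "real N' \<le> 2 + (1 + 3 * sqrt \<kappa>) * ln (3 * (1 + \<kappa>))"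
        and gap: "f x' + fin h x' + l' \<bullet> (A *v x' - b) - e K \<le> v"
        and contr: "(norm (l' - ls))\<^sup>2 + (norm (l' - l))\<^sup>2 \<le> (norm (l - ls))\<^sup>2 + 2 * \<rho> * e K"
        and l': "l' = l + \<rho> *\<^sub>R (A *v x' - b)"
        by (rule outer_iteration[where tie = "tie K" and l = l, OF \<rho>(1) e_pos[of K] x xs ls,
              folded \<kappa>_def], assumption) (rule that)
      have "0 \<le> \<kappa>" using aug_M_pos[OF \<rho>(1)] e_pos[of K] by (simp add: \<kappa>_def ialm_mu_def)
      moreover have "sqrt \<kappa> \<le> 16 * c * Q"
        unfolding \<kappa>_def \<rho>_def Q_def c_def \<delta>_def
        using \<alpha> R0 \<epsilon> e_bounds(1)[of K] unfolding \<delta>_def by (rule sqrt_condition_number_le)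
      ultimately have N'B: "real N' \<le> B"
        using N' inner_cost_le[OF _ _ c Q] unfolding B_def by (blast intro: order_trans)
      have total: "real (N + N') \<le> (real K + 1) * B" using N N'B by (simp add: algebra_simps)
      have step: "norm (l' - l) = \<rho> * norm (A *v x' - b)" using \<rho> by (simp add: l')
      show ?thesis
      proof (cases "norm (A *v x' - b) \<le> \<delta>")
        case True
        have "e K / (2 * D) \<le> e K / 2" using e_pos[of K] D1 by (simp add: field_simps)
        then have "norm (ialm_G f Lf h D A b \<rho> (e K) l y) \<le> \<delta> / 2"
          using G e_bounds(2)[of K] \<delta> by linarith
        then have "ialm_stop f Lf h D A b \<rho> \<delta> (e K) l y x'" using True by (simp add: ialm_stop_def)
        then have "ialm_returns f Lf h D A b x0 \<rho> \<delta> \<alpha> \<delta> (1/2) tie x' l' (N + N')"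
          by (rule ialm_returns.intros[OF reach e_def out])
        \<comment> \<open>The summand 1 pays for the returning iteration.\<close>
        moreover have "real (N + N') \<le> (2 * R\<^sup>2 + 2 * c + 1) * B"
          using total K_le(1)[OF inv] mult_right_mono[OF _ B, of "real K + 1" "2 * R\<^sup>2 + 2 * c + 1"] by linarith
        moreover have "primal_sol f h A b \<epsilon> x'"
        proof -
          have "\<rho> * norm (A *v x' - b) \<le> \<rho> * \<delta>" using True \<rho>(1) by simp
          \<comment> \<open>1 for the last move, R + c for the distance of \<open>l\<close> from
            \<open>ls\<close>, R for the norm of \<open>ls\<close>.\<close>
          then have "norm l' \<le> 2 * R + c + 1"
            using norm_triangle_ineq[of "l' - l" "(l - ls) + ls"] norm_triangle_ineq[of "l - ls" ls]
              K_le(2)[OF inv] \<rho>(2) step R by simp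
          then have "norm l' * norm (A *v x' - b) \<le> (2 * R + c + 1) * \<delta>"
            using True R0 c by (intro mult_mono) auto
          then have "- (l' \<bullet> (A *v x' - b)) \<le> (2 * R + c + 1) * \<delta>"
            using norm_cauchy_schwarz[of "- l'" "A *v x' - b"] by simp
          \<comment> \<open>7/4 is the 1 above plus the 3/4 from the inexactness of the last
            iteration.\<close>
          then have "f x' + fin h x' - v \<le> \<delta> * (2 * R + c + 7 / 4)"
            using gap e_bounds(2)[of K] by (simp add: algebra_simps)
          also have "\<dots> \<le> \<delta> * (4 * c * (R + D))"
          proof (rule mult_left_mono)
            show "2 * R + c + 7 / 4 \<le> 4 * c * (R + D)" unfolding cRD using c R0 cR cD by linarith
          qed (use \<delta> in simp)
          finally have upper: "f x' + fin h x' - v \<le> \<epsilon>" by (simp add: \<delta>\<epsilon>)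
          have RD4: "R \<le> 4 * c * (R + D)" "1 \<le> 4 * c * (R + D)"
            unfolding cRD using c R0 cR cD by linarith+
          \<comment> \<open>The value can fall below the optimum only by what the violation earns
            against \<open>ls\<close>.\<close>
          have "ls \<bullet> (A *v x' - b) \<le> R * \<delta>"
            using order_trans[OF norm_cauchy_schwarz mult_left_mono[OF True]] R by simp
          also have "\<dots> \<le> \<epsilon>" using mult_left_mono[OF RD4(1), of \<delta>] \<delta> unfolding \<delta>\<epsilon> by (simp add: mult.commute)
          finally have lower: "v - (f x' + fin h x') \<le> \<epsilon>" using ls[OF x'] by simp
          have "\<delta> \<le> \<epsilon>" using mult_left_mono[OF RD4(2), of \<delta>] \<delta> unfolding \<delta>\<epsilon> by simp
          then show ?thesis
            using x' upper lower True by (simp add: primal_sol_def objective_fin v abs_le_iff)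
        qed
        ultimately show ?thesis unfolding \<rho>_def by blast
      next
        case False
        then have "\<not> ialm_stop f Lf h D A b \<rho> \<delta> (e K) l y x'" by (simp add: ialm_stop_def)
        then have "?reach (Suc K) x' l' (N + N')"
          by (rule ialm_reach.step[OF reach e_def out])
        moreover have "\<rho> * \<delta> \<le> norm (l' - l)" unfolding step using False \<rho>(1) by simp
        then have "1\<^sup>2 \<le> (norm (l' - l))\<^sup>2" unfolding \<rho>(2) by (intro power_mono) auto
        then have "(norm (l' - ls))\<^sup>2 + real (Suc K) / 2 \<le> R\<^sup>2 + (\<Sum>k<Suc K. \<alpha> ^ k)"
          using contr I unfolding \<rho>e one_power2 sum.lessThan_Suc of_nat_Suc add_divide_distrib
          by linarith
        moreover have "real (N + N') \<le> real (Suc K) * B" using total by (simp add: add.commute)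
        ultimately have "inv (Suc K) x' l' (N + N')" using x' unfolding inv_def by blast
        then show ?thesis by blast
      qed
    qed (rule disjI1)
  qed
  \<comment> \<open>Evaluated one index beyond the cap on K, where the invariant is
    contradictory.\<close>
  then have "?goal \<or> (\<exists>x l N. inv (Suc (nat \<lceil>2 * R\<^sup>2 + 2 * c\<rceil>)) x l N)" .
  moreover have False if "inv (Suc (nat \<lceil>2 * R\<^sup>2 + 2 * c\<rceil>)) x l N" for x l N
    using K_le(1)[OF that] real_nat_ceiling_ge[of "2 * R\<^sup>2 + 2 * c"] by simp
  ultimately show ?goal by metis
qed

end

section \<open>From the explicit count to the soft-O bound\<close>

theorem corollary3p2:
  fixes f :: "real^'n \<Rightarrow> real" and h :: "real^'n \<Rightarrow> ereal"
    and A :: "real^'n^'m" and b :: "real^'m" and x0 :: "real^'n"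
    and Lf D R \<alpha> \<epsilon> \<delta> :: real and tie :: "nat \<Rightarrow> nat \<Rightarrow> bool"
  assumes "CARD('m) \<le> CARD('n)"
    and "smooth_convex Lf f"
    and "proper_closed_convex h"
    and "0 < Lf \<or> A \<noteq> 0"
    and "rel_interior (edom h) \<inter> {x. A *v x = b} \<noteq> {}"
    and "bounded (edom h)" and "D = diameter (edom h)" and "1 \<le> D"
    and "R = Inf ((\<lambda>l. norm (l - 0)) ` dual_opt f h A b)"
    and "x0 \<in> edom h" and "0 < \<alpha>" and "\<alpha> < 1" and "0 < \<epsilon>"
    and "\<delta> = primal_tol \<alpha> R D \<epsilon>"
  shows "\<exists>x l N.
    ialm_returns f Lf h D A b x0 (inverse \<delta>) \<delta> \<alpha> \<delta> (1/2) tie x l N \<and>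
    primal_sol f h A b \<epsilon> x \<and>
    real N \<le> soft_O \<alpha> ((1 + R\<^sup>2) * (1 + D * (sqrt ((R + D) * Lf) / sqrt \<epsilon>
                                          + (R + D) * onorm ((*v) A) / \<epsilon>)))"
proof -
  interpret constrained_problem f h A b Lf D
  proof
    fix u v assume "u \<in> edom h" "v \<in> edom h"
    then show "norm (u - v) \<le> D"
      using diameter_bounded_bound[OF assms(6)] assms(7) by (simp add: dist_norm)
  qed (use assms in auto)
  obtain v ls where v: "opt_val f h A b = ereal v" and "norm ls = R"
    and ls: "\<And>w. w \<in> edom h \<Longrightarrow> v \<le> f w + fin h w + ls \<bullet> (A *v w - b)"
    and "\<exists>x\<in>edom h. A *v x = b \<and> f x + fin h x = v"
    by (rule min_norm_multiplier[OF assms(5), folded assms(9)]) (rule that)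
  then obtain xs where xs: "xs \<in> edom h" "A *v xs = b" "f xs + fin h xs = v" and R: "R = norm ls"
    by blast
  define c Q where "c = 1 / (1 - \<alpha>)"
    and "Q = D * (sqrt ((R + D) * Lf) / sqrt \<epsilon> + (R + D) * onorm ((*v) A) / \<epsilon>)"
  obtain x l N where ret: "ialm_returns f Lf h D A b x0 (inverse \<delta>) \<delta> \<alpha> \<delta> (1/2) tie x l N"
    and sol: "primal_sol f h A b \<epsilon> x"
    and N: "real N \<le> (2 * R\<^sup>2 + 2 * c + 1) * (482 * c\<^sup>2 * ((1 + Q) * (1 + ln (1 + Q))))"
    using ialm_terminates[OF assms(10-13) xs v ls R, of tie, folded c_def Q_def assms(14)] by blast
  have c: "1 \<le> c" using assms(11,12) by (simp add: c_def)
  have RD: "0 \<le> R + D" using R assms(8) by (simp add: add_nonneg_nonneg)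
  have Q: "0 \<le> Q"
    unfolding Q_def using assms(8,13) RD Lf_nonneg onorm_A_nonneg by simp
  define X where "X = (1 + R\<^sup>2) * (1 + Q)"
  have "1 * (1 + Q) \<le> X" unfolding X_def using Q by (intro mult_right_mono) auto
  then have lnX: "ln (1 + Q) \<le> ln X" using Q by simp
  have lnQ: "0 \<le> ln (1 + Q)" using Q by simp
  \<comment> \<open>The outer count is gathered into 3 c (1 + R^2); with the cost factor 482 c^2 per
    outer iteration this gives 1446 c^3, within the constant of \<open>soft_O\<close>.\<close>
  have "R\<^sup>2 \<le> c * R\<^sup>2" using mult_right_mono[OF c zero_le_power2[of R]] by simp
  moreover have "3 * c * (1 + R\<^sup>2) = 3 * c + 3 * (c * R\<^sup>2)" by (simp add: algebra_simps)
  ultimately have "2 * R\<^sup>2 + 2 * c + 1 \<le> 3 * c * (1 + R\<^sup>2)"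
    using c zero_le_power2[of R] by linarith
  then have "(2 * R\<^sup>2 + 2 * c + 1) * (482 * c\<^sup>2 * ((1 + Q) * (1 + ln (1 + Q))))
      \<le> (3 * c * (1 + R\<^sup>2)) * (482 * c\<^sup>2 * ((1 + Q) * (1 + ln X)))"
    using c Q lnQ lnX by (intro mult_mono mult_left_mono) auto
  also have "\<dots> = 1446 * (c ^ 3 * (X * (1 + ln X)))"
    by (simp add: X_def power2_eq_square power3_eq_cube)
  also have "\<dots> \<le> 10000 * (c ^ 3 * (X * (1 + ln X)))"
  proof (rule mult_right_mono)
    have "0 \<le> X" using Q by (simp add: X_def)
    moreover have "0 \<le> ln X" using lnQ lnX by (rule order_trans)
    ultimately show "0 \<le> c ^ 3 * (X * (1 + ln X))" using c by simp
  qed simp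
  also have "\<dots> = soft_O \<alpha> X" by (simp add: soft_O_def c_def power_divide)
  finally have "real N \<le> soft_O \<alpha> X" using N by simp
  then show ?thesis using ret sol unfolding X_def Q_def by blast
qed

end
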